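(* Every bipartite brick $T_0$ with $a\le b$ has a well-defined invariant triple consisting of - its imbalance class: balanced ($a=b$) or unbalanced ($a<b$); - its characteristic type: excessive ($m>0$), liminal ($m=0$) or deficient ($m<0$); - its $C$-count class: $k=0$, $k=1$ or $k>1$, where $k$ is the number of $C$-blocks in its excessive decomposition; and distinct triples give disjoint classes. Of the $18$ a priori possible triples, exactly the following eleven occur, and each of them is attained; each determines the block composition as indicated: 1. (balanced, excessive, $k=1$): $C$; 2. (unbalanced, excessive, $k=0$): $E$; 3. (balanced, liminal, $k>1$): $C_1,\dots,C_k$; 4. (unbalanced, liminal, $k=1$): $C,E$; 5. (unbalanced, liminal, $k>1$): $C_1,\dots,C_k,E$; 6. (balanced, deficient, $k=0$): $D,E$; 7. (balanced, deficient, $k=1$): $D,C,E$; 8. (balanced, deficient, $k>1$): $D,C_1,\dots,C_k,E$; 9. (unbalanced, deficient, $k=0$): $D,E$; 10. (unbalanced, deficient, $k=1$): $D,C,E$; 11. (unbalanced, deficient, $k>1$): $D,C_1,\dots,C_k,E$. The triple is a complete, canonical invariant of the block composition of $T_0$ (i.e. of which of $D$, $C$-blocks and $E$ are present). The seven excluded triples are precisely those violating one of the following two laws: (I) if $T_0$ is excessive, its excessive decomposition is the single block $T_0$, which is a $C$-block ($k=1$) if $T_0$ is balanced and an $E$-block ($k=0$) if unbalanced; (II) if $T_0$ is liminal, then $k\ge1$, and if moreover it is balanced, then $k\ge 2$.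
   Context: $T_0=B\times A$ is the grid (rows $B$, $|B|=b$; columns $A$, $|A|=a$) of a finite simple bipartite graph $G_0$ without isolated vertices; a dot in cell $(y,x)$ means $x$ and $y$ are adjacent. A brick $T=Y\times X$ (nonempty $Y\subseteq B$, $X\subseteq A$) is identified with the subgraph induced on $X\cup Y$; $\mathrm{row}(T)=Y$, $\mathrm{col}(T)=X$, $\mathrm{vcount}(T)=|X|+|Y|$, $\mathrm{long}(T)=\max\{|X|,|Y|\}$. $T$ is balanced if $|X|=|Y|$, horizontal if $|X|>|Y|$, vertical if $|X|<|Y|$. A hole of $T$ is a dot-free sub-brick $Y'\times X'$ with $\emptyset\neq Y'\subsetneq Y$, $\emptyset\ne X'\subsetneq X$; $\alpha_p(T)$ is the maximum vcount of a hole of $T$ ($0$ if none). The characteristic of $T$ is $m=\mathrm{long}(T)-\alpha_p(T)$; $T$ is excessive if $m>0$, liminal if $m=0$, deficient if $m<0$. An ordered partition of $T_0$ (its row set and column set both being partitioned) into bricks $B_1,\dots,B_r$ is in block triangular form (BTF) if there is no edge between $\mathrm{row}(B_i)$ and $\mathrm{col}(B_j)$ whenever $i>j$. The excessive decomposition of $T_0$ is the BTF partition, in this order, into excessive bricks $D,C_1,\dots,C_k,E$ (any may be absent) with $D$ horizontal, each $C_i$ balanced, $E$ vertical; it exists and is unique up to the order of the $C$-blocks.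
   Formalization: Blocks of the excessive decomposition must contain a dot (dot-free 1×1 C-blocks would make k non-unique); and, since D,E occurs in both items 6 and 9, the "complete invariant" claim is stated as: triples agree iff imbalance class and block composition agree. *)

theory Defs
  imports Main "HOL-Library.Disjoint_Sets" "HOL-Library.Multiset"
begin

text \<open>
  A bipartite graph is given by its set of dots \<open>G\<close>: \<open>(y, x) \<in> G\<close> means that the row vertex \<open>y\<close>
  and the column vertex \<open>x\<close> are adjacent. Rows and columns have separate types, so the two
  sides of the bipartition are automatically disjoint.
\<close>

datatype ('r, 'c) brick = Brick (row: "'r set") (col: "'c set")

definition vcount :: "('r, 'c) brick \<Rightarrow> nat" where
  "vcount T = card (col T) + card (row T)"

definition long :: "('r, 'c) brick \<Rightarrow> nat" where
  "long T = max (card (col T)) (card (row T))"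

definition balanced :: "('r, 'c) brick \<Rightarrow> bool" where
  "balanced T \<longleftrightarrow> card (col T) = card (row T)"

definition horizontal :: "('r, 'c) brick \<Rightarrow> bool" where
  "horizontal T \<longleftrightarrow> card (col T) > card (row T)"

definition vertical :: "('r, 'c) brick \<Rightarrow> bool" where
  "vertical T \<longleftrightarrow> card (col T) < card (row T)"

definition dot_free :: "('r \<times> 'c) set \<Rightarrow> ('r, 'c) brick \<Rightarrow> bool" where
  "dot_free G T \<longleftrightarrow> G \<inter> row T \<times> col T = {}"

definition hole :: "('r \<times> 'c) set \<Rightarrow> ('r, 'c) brick \<Rightarrow> ('r, 'c) brick \<Rightarrow> bool" where
  "hole G T H \<longleftrightarrow> row H \<noteq> {} \<and> row H \<subset> row T \<and> col H \<noteq> {} \<and> col H \<subset> col T \<and> dot_free G H"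

definition alpha_p :: "('r \<times> 'c) set \<Rightarrow> ('r, 'c) brick \<Rightarrow> nat" where
  "alpha_p G T = Max (insert 0 {vcount H | H. hole G T H})"

definition characteristic :: "('r \<times> 'c) set \<Rightarrow> ('r, 'c) brick \<Rightarrow> int" where
  "characteristic G T = int (long T) - int (alpha_p G T)"

definition excessive :: "('r \<times> 'c) set \<Rightarrow> ('r, 'c) brick \<Rightarrow> bool" where
  "excessive G T \<longleftrightarrow> characteristic G T > 0"

definition liminal :: "('r \<times> 'c) set \<Rightarrow> ('r, 'c) brick \<Rightarrow> bool" where
  "liminal G T \<longleftrightarrow> characteristic G T = 0"

definition deficient :: "('r \<times> 'c) set \<Rightarrow> ('r, 'c) brick \<Rightarrow> bool" where
  "deficient G T \<longleftrightarrow> characteristic G T < 0"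

text \<open>\<open>T0\<close> is the grid of a finite bipartite graph without isolated vertices, with \<open>a \<le> b\<close>.\<close>

definition tall_grid :: "('r \<times> 'c) set \<Rightarrow> ('r, 'c) brick \<Rightarrow> bool" where
  "tall_grid G T0 \<longleftrightarrow>
     finite (row T0) \<and> row T0 \<noteq> {} \<and> finite (col T0) \<and> col T0 \<noteq> {} \<and>
     G \<subseteq> row T0 \<times> col T0 \<and>
     (\<forall>y \<in> row T0. \<exists>x \<in> col T0. (y, x) \<in> G) \<and>
     (\<forall>x \<in> col T0. \<exists>y \<in> row T0. (y, x) \<in> G) \<and>
     card (col T0) \<le> card (row T0)"

definition btf_partition ::
  "('r \<times> 'c) set \<Rightarrow> ('r, 'c) brick \<Rightarrow> ('r, 'c) brick list \<Rightarrow> bool" where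
  "btf_partition G T0 Bs \<longleftrightarrow>
     distinct (map row Bs) \<and> partition_on (row T0) (set (map row Bs)) \<and>
     distinct (map col Bs) \<and> partition_on (col T0) (set (map col Bs)) \<and>
     (\<forall>i < length Bs. \<forall>j < i. G \<inter> row (Bs ! i) \<times> col (Bs ! j) = {})"

datatype ('r, 'c) decomposition =
  Decomposition
    (D_block: "('r, 'c) brick option")
    (C_blocks: "('r, 'c) brick list")
    (E_block: "('r, 'c) brick option")

fun option_to_list :: "'a option \<Rightarrow> 'a list" where
  "option_to_list None = []"
| "option_to_list (Some x) = [x]"

definition blocks :: "('r, 'c) decomposition \<Rightarrow> ('r, 'c) brick list" where
  "blocks d = option_to_list (D_block d) @ C_blocks d @ option_to_list (E_block d)"

text \<open>
  Blocks are required to contain a dot. This only excludes the dot-free \<open>1 \<times> 1\<close> brick as a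
  \<open>C\<close>-block: it has no holes, hence characteristic \<open>1\<close>, and admitting it would destroy the
  uniqueness of the decomposition, and even of the number of \<open>C\<close>-blocks. For example, with
  rows \<open>1, 2, 3, 4\<close>, columns \<open>1, 2, 3, 4\<close> and dots
  \<open>(1,1), (1,2), (1,3), (2,4), (3,4), (4,4)\<close>, the two partitions
  \<open>{1} \<times> {1,2}, {2} \<times> {3}, {3,4} \<times> {4}\<close> and \<open>{1} \<times> {1,2,3}, {2,3,4} \<times> {4}\<close> would both qualify.
  All other bricks that can occur as blocks contain a dot in every row and column anyway.
\<close>

definition excessive_decomposition ::
  "('r \<times> 'c) set \<Rightarrow> ('r, 'c) brick \<Rightarrow> ('r, 'c) decomposition \<Rightarrow> bool" where
  "excessive_decomposition G T0 d \<longleftrightarrow>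
     btf_partition G T0 (blocks d) \<and>
     (\<forall>T \<in> set (blocks d). excessive G T \<and> \<not> dot_free G T) \<and>
     (\<forall>T \<in> set_option (D_block d). horizontal T) \<and>
     (\<forall>T \<in> set (C_blocks d). balanced T) \<and>
     (\<forall>T \<in> set_option (E_block d). vertical T)"

datatype imbalance = Balanced | Unbalanced

datatype char_type = Excessive | Liminal | Deficient

datatype count_class = Zero | One | Many

type_synonym triple = "imbalance \<times> char_type \<times> count_class"

definition imbalance_of :: "('r, 'c) brick \<Rightarrow> imbalance" where
  "imbalance_of T = (if balanced T then Balanced else Unbalanced)"

definition char_type_of :: "('r \<times> 'c) set \<Rightarrow> ('r, 'c) brick \<Rightarrow> char_type" where
  "char_type_of G T =
     (if excessive G T then Excessive else if liminal G T then Liminal else Deficient)"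

definition count_class_of :: "nat \<Rightarrow> count_class" where
  "count_class_of k = (if k = 0 then Zero else if k = 1 then One else Many)"

definition has_triple :: "('r \<times> 'c) set \<Rightarrow> ('r, 'c) brick \<Rightarrow> triple \<Rightarrow> bool" where
  "has_triple G T0 t \<longleftrightarrow>
     (\<exists>d. excessive_decomposition G T0 d \<and>
          t = (imbalance_of T0, char_type_of G T0, count_class_of (length (C_blocks d))))"

definition triple_class :: "triple \<Rightarrow> (('r \<times> 'c) set \<times> ('r, 'c) brick) set" where
  "triple_class t = {(G, T0). tall_grid G T0 \<and> has_triple G T0 t}"

text \<open>
  A block composition records whether \<open>D\<close> is present, whether there are no, one or several
  \<open>C\<close>-blocks, and whether \<open>E\<close> is present.
\<close>

type_synonym composition = "bool \<times> count_class \<times> bool"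

definition composition_of :: "('r, 'c) decomposition \<Rightarrow> composition" where
  "composition_of d =
     (D_block d \<noteq> None, count_class_of (length (C_blocks d)), E_block d \<noteq> None)"

definition composition_table :: "(triple \<times> composition) list" where
  "composition_table =
    [((Balanced,   Excessive, One),  (False, One,  False)),
     ((Unbalanced, Excessive, Zero), (False, Zero, True)),
     ((Balanced,   Liminal,   Many), (False, Many, False)),
     ((Unbalanced, Liminal,   One),  (False, One,  True)),
     ((Unbalanced, Liminal,   Many), (False, Many, True)),
     ((Balanced,   Deficient, Zero), (True,  Zero, True)),
     ((Balanced,   Deficient, One),  (True,  One,  True)),
     ((Balanced,   Deficient, Many), (True,  Many, True)),
     ((Unbalanced, Deficient, Zero), (True,  Zero, True)),
     ((Unbalanced, Deficient, One),  (True,  One,  True)),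
     ((Unbalanced, Deficient, Many), (True,  Many, True))]"

text \<open>The two laws, read as conditions on an abstract triple.\<close>

fun law_I :: "triple \<Rightarrow> bool" where
  "law_I (i, c, k) \<longleftrightarrow> (c = Excessive \<longrightarrow> k = (if i = Balanced then One else Zero))"

fun law_II :: "triple \<Rightarrow> bool" where
  "law_II (i, c, k) \<longleftrightarrow> (c = Liminal \<longrightarrow> k \<noteq> Zero \<and> (i = Balanced \<longrightarrow> k = Many))"

end

(*
  Write surplus(S) = |S| - |N(S)| for a set S of columns. In a block B of an excessive
  decomposition, |S| + |row(B)| <= |N_B(S)| + long(B) for all S <= col(B), with equality only if S is
  empty or all of col(B). Summing over the blocks bounds the surplus of every S, and a set attains
  the maximum (a tight set) only if it contains or avoids each block. Suitable prefixes of the block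
  order are tight, so tight sets also separate any two blocks: the blocks are exactly the classes of
  columns lying in the same tight sets, whence uniqueness.
  Conversely, the successive differences of a maximal chain of tight sets are the blocks of a
  decomposition. If D is present, its columns together with all other rows form a hole larger than
  long(T0); if it is absent, no surplus is positive, so no hole exceeds long(T0), and the columns of
  a first C-block followed by further blocks give a hole of exactly this size.
*)
theory Submission
  imports Defs
begin

subsection \<open>Holes and block triangular partitions\<close>

lemma finite_hole_vcounts:
  assumes "finite (row T)" "finite (col T)"
  shows "finite {vcount H | H. hole G T H}"
proof (rule finite_subset)
  show "{vcount H | H. hole G T H} \<subseteq> (\<lambda>(R, S). vcount (Brick R S)) ` (Pow (row T) \<times> Pow (col T))"
  proof
    fix n assume "n \<in> {vcount H | H. hole G T H}"
    then obtain H where "n = vcount H" "hole G T H" by blast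
    then show "n \<in> (\<lambda>(R, S). vcount (Brick R S)) ` (Pow (row T) \<times> Pow (col T))"
      by (intro image_eqI[of _ _ "(row H, col H)"]) (auto simp: hole_def)
  qed
qed (use assms in auto)

lemma vcount_le_alpha_p:
  assumes "finite (row T)" "finite (col T)" "hole G T H"
  shows "vcount H \<le> alpha_p G T"
  unfolding alpha_p_def using finite_hole_vcounts[OF assms(1,2)] assms(3)
  by (intro Max_ge) auto

lemma alpha_p_le:
  assumes "finite (row T)" "finite (col T)" "\<And>H. hole G T H \<Longrightarrow> vcount H \<le> n"
  shows "alpha_p G T \<le> n"
  unfolding alpha_p_def using finite_hole_vcounts[OF assms(1,2)] assms(3)
  by (subst Max_le_iff) auto

lemma excessiveI:
  assumes "finite (row T)" "finite (col T)" "row T \<noteq> {}"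
    and "\<And>H. hole G T H \<Longrightarrow> vcount H < long T"
  shows "excessive G T"
proof -
  \<comment> \<open>Positivity makes the truncated difference \<open>long T - 1\<close> faithful,
    also when there is no hole and \<open>alpha_p\<close> takes its default value 0.\<close>
  have "0 < long T" using assms(1,3) by (auto simp: long_def card_gt_0_iff less_max_iff_disj)
  moreover have "alpha_p G T \<le> long T - 1"
    by (rule alpha_p_le) (use assms in force)+
  ultimately show ?thesis by (simp add: excessive_def characteristic_def)
qed

lemma excessive_hole:
  assumes "excessive G T" "finite (row T)" "finite (col T)"
    and "R \<noteq> {}" "R \<subset> row T" "S \<noteq> {}" "S \<subset> col T" "G \<inter> R \<times> S = {}"
  shows "card R + card S < long T"
proof -
  have "hole G T (Brick R S)" using assms by (simp add: hole_def dot_free_def)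
  from vcount_le_alpha_p[OF assms(2,3) this] show ?thesis
    using assms(1) by (simp add: excessive_def characteristic_def vcount_def)
qed

text \<open>An uncovered column \<open>x\<close>, paired with all rows but one, would be a hole with
  as many vertices as \<open>T\<close> has rows, which is \<open>long T\<close> for a brick that is
  not horizontal. One row is dropped because a hole must be proper in both directions; the dot
  ensures that \<open>x\<close> is not the only column.\<close>

lemma excessive_col_covered:
  assumes "excessive G T" "\<not> dot_free G T" "finite (row T)" "finite (col T)"
    and "\<not> horizontal T" "x \<in> col T"
  shows "x \<in> G `` row T"
proof (rule ccontr)
  assume x: "x \<notin> G `` row T"
  have "col T \<noteq> {x}" using x assms(2) by (auto simp: dot_free_def)
  then have "{x} \<subset> col T" using assms(6) by blast
  then have "1 < card (col T)" using psubset_card_mono[OF assms(4), of "{x}"] by simp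
  then have c: "1 < card (row T)" using assms(5) by (simp add: horizontal_def)
  then have "row T \<noteq> {}" by auto
  then obtain y where y: "y \<in> row T" by blast
  have "card (row T - {y}) \<noteq> 0" using c y by simp
  then have "row T - {y} \<noteq> {}" by (metis card.empty)
  then have "card (row T - {y}) + card {x} < long T"
    using assms x y \<open>{x} \<subset> col T\<close> by (intro excessive_hole) auto
  then show False using y c assms(3,5) by (simp add: long_def horizontal_def)
qed

text \<open>The mirror image: an uncovered row with all columns but one would be a hole of size
  \<open>long T\<close>.\<close>

lemma excessive_row_covered:
  assumes "excessive G T" "\<not> dot_free G T" "finite (row T)" "finite (col T)"
    and "\<not> vertical T" "y \<in> row T"
  shows "y \<in> G\<inverse> `` col T"
proof (rule ccontr)
  assume y: "y \<notin> G\<inverse> `` col T"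
  have "row T \<noteq> {y}" using y assms(2) by (auto simp: dot_free_def)
  then have "{y} \<subset> row T" using assms(6) by blast
  then have "1 < card (row T)" using psubset_card_mono[OF assms(3), of "{y}"] by simp
  then have c: "1 < card (col T)" using assms(5) by (simp add: vertical_def)
  then have "col T \<noteq> {}" by auto
  then obtain x where x: "x \<in> col T" by blast
  have "card (col T - {x}) \<noteq> 0" using c x by simp
  then have "col T - {x} \<noteq> {}" by (metis card.empty)
  then have "card {y} + card (col T - {x}) < long T"
    using assms x y \<open>{y} \<subset> row T\<close> by (intro excessive_hole) auto
  then show False using x c assms(4,5) by (simp add: long_def vertical_def)
qed

text \<open>For a nonempty proper \<open>S\<close>, the rows of \<open>T\<close> outside
  \<open>R\<close> form a hole with \<open>S\<close>, and excessiveness makes the inequality strict.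
  If \<open>R\<close> already contains all rows there is no such hole, but then \<open>S\<close>
  having fewer columns than \<open>T\<close> suffices. So equality is left to the two extreme
  choices of \<open>S\<close>.\<close>

lemma excessive_surplus:
  assumes "excessive G T" "finite (row T)" "finite (col T)" "S \<subseteq> col T"
    and cols: "col T \<subseteq> G `` row T" and rows: "row T \<subseteq> G\<inverse> `` col T"
    and R: "R = G\<inverse> `` S \<inter> row T"
  shows "card S + card (row T) \<le> card R + long T"
    and "card S + card (row T) = card R + long T \<Longrightarrow>
      S = {} \<and> R = {} \<or> S = col T \<and> R = row T"
proof -
  have strict: "card S + card (row T) < card R + long T" if S: "S \<noteq> {}" "S \<subset> col T"
  proof (cases "R = row T")
    case True
    then show ?thesis using psubset_card_mono[OF assms(3) S(2)] by (simp add: long_def)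
  next
    case False
    have "R \<noteq> {}" using S cols R by blast
    then have "card (row T - R) + card S < long T"
      using assms(1-3) S False R by (intro excessive_hole) auto
    moreover have "card (row T - R) = card (row T) - card R" "card R \<le> card (row T)"
      using R assms(2) by (auto simp: card_Diff_subset card_mono)
    ultimately show ?thesis by linarith
  qed
  have full: "R = row T" if "S = col T" using that rows R by blast
  show "card S + card (row T) \<le> card R + long T"
  proof -
    consider "S = {}" | "S = col T" | "S \<noteq> {}" "S \<subset> col T" using assms(4) by blast
    then show ?thesis by cases (use strict full in \<open>auto simp: long_def\<close>)
  qed
  show "S = {} \<and> R = {} \<or> S = col T \<and> R = row T"
    if "card S + card (row T) = card R + long T"
  proof -
    consider "S = {}" | "S = col T" | "S \<noteq> {}" "S \<subset> col T" using assms(4) by blast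
    then show ?thesis by cases (use that strict full in \<open>simp_all add: R\<close>)
  qed
qed

section \<open>Calculus of block triangular partitions\<close>

lemma btf_partition_Nil: "btf_partition G T [] \<longleftrightarrow> row T = {} \<and> col T = {}"
  by (auto simp: btf_partition_def partition_on_def)

lemma btf_partition_single:
  "btf_partition G T [B] \<longleftrightarrow> row T \<noteq> {} \<and> col T \<noteq> {} \<and> B = T"
  by (cases B; cases T) (auto simp: btf_partition_def partition_on_def)

text \<open>This lets a decomposition be built from the front: the new first block only has to
  receive no edge from the rows left for the later blocks.\<close>

lemma btf_partition_Cons:
  assumes "btf_partition G (Brick (row T - row B) (col T - col B)) Bs"
    and "row B \<noteq> {}" "col B \<noteq> {}" "row B \<subseteq> row T" "col B \<subseteq> col T"
    and "G \<inter> (row T - row B) \<times> col B = {}"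
  shows "btf_partition G T (B # Bs)"
proof -
  have rows: "\<Union>(row ` set Bs) = row T - row B" and cols: "\<Union>(col ` set Bs) = col T - col B"
    using assms(1) by (auto simp: btf_partition_def partition_on_def)
  have "row B \<notin> row ` set Bs" "col B \<notin> col ` set Bs" using rows cols assms(2,3) by blast+
  moreover have "partition_on (row T) (insert (row B) (row ` set Bs))"
  proof -
    have "partition_on (row T - row B) (row ` set Bs)" using assms(1)
      by (simp add: btf_partition_def)
    then show ?thesis using assms(2,4)
      by (subst partition_on_insert) (auto simp: disjnt_def rows)
  qed
  moreover have "partition_on (col T) (insert (col B) (col ` set Bs))"
  proof -
    have "partition_on (col T - col B) (col ` set Bs)" using assms(1)
      by (simp add: btf_partition_def)
    then show ?thesis using assms(3,5)
      by (subst partition_on_insert) (auto simp: disjnt_def cols)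
  qed
  moreover have "G \<inter> row ((B # Bs) ! i) \<times> col ((B # Bs) ! j) = {}"
    if ij: "i < length (B # Bs)" "j < i" for i j
  proof (cases j)
    case 0
    then obtain i' where "i = Suc i'" "i' < length Bs" using ij 0 by (cases i) auto
    then have "row ((B # Bs) ! i) \<subseteq> row T - row B" using rows nth_mem by fastforce
    then show ?thesis using assms(6) 0 by auto
  next
    case (Suc j')
    then show ?thesis using ij assms(1) by (cases i) (auto simp: btf_partition_def)
  qed
  ultimately show ?thesis using assms(1) by (simp add: btf_partition_def)
qed

lemma btf_partition_disjoint:
  assumes "btf_partition G T Bs" "B \<in> set Bs" "B' \<in> set Bs" "B \<noteq> B'"
  shows "row B \<inter> row B' = {}" "col B \<inter> col B' = {}"
proof -
  have inj: "inj_on row (set Bs)" "inj_on col (set Bs)"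
    and dj: "disjoint (row ` set Bs)" "disjoint (col ` set Bs)"
    using assms(1) by (auto simp: btf_partition_def distinct_map partition_on_def)
  have "row B \<noteq> row B'" "col B \<noteq> col B'" using inj assms(2-4) by (auto dest: inj_onD)
  then show "row B \<inter> row B' = {}" "col B \<inter> col B' = {}"
    using dj assms(2,3) by (auto dest: disjointD)
qed

lemma btf_partition_Union:
  assumes "btf_partition G T Bs"
  shows "(\<Union>B \<in> set Bs. row B) = row T" "(\<Union>B \<in> set Bs. col B) = col T"
  using assms by (auto simp: btf_partition_def partition_on_def)

lemma btf_partition_nonempty:
  assumes "btf_partition G T Bs" "B \<in> set Bs"
  shows "row B \<noteq> {}" "col B \<noteq> {}"
  using assms by (auto simp: btf_partition_def partition_on_def)

lemma btf_partition_subset: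
  assumes "btf_partition G T Bs" "B \<in> set Bs"
  shows "row B \<subseteq> row T" "col B \<subseteq> col T"
  using btf_partition_Union[OF assms(1)] assms(2) by auto

lemma btf_partition_distinct: "btf_partition G T Bs \<Longrightarrow> distinct Bs"
  by (simp add: btf_partition_def distinct_map)

lemma btf_partition_no_edge:
  assumes "btf_partition G T Bs" "j < i" "i < length Bs" "y \<in> row (Bs ! i)" "x \<in> col (Bs ! j)"
  shows "(y, x) \<notin> G"
  using assms unfolding btf_partition_def by blast

lemma card_eq_sum_blocks:
  assumes "finite I" "finite S" "S \<subseteq> (\<Union>B \<in> I. f B)"
    and "\<And>B B'. B \<in> I \<Longrightarrow> B' \<in> I \<Longrightarrow> B \<noteq> B' \<Longrightarrow> f B \<inter> f B' = {}"
  shows "card S = (\<Sum>B \<in> I. card (S \<inter> f B))"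
proof -
  have "S = (\<Union>B \<in> I. S \<inter> f B)" using assms(3) by blast
  then have "card S = card (\<Union>B \<in> I. S \<inter> f B)" by simp
  also have "\<dots> = (\<Sum>B \<in> I. card (S \<inter> f B))"
    using assms by (intro card_UN_disjoint) blast+
  finally show ?thesis .
qed

lemma btf_partition_card:
  assumes "btf_partition G T Bs"
  shows "finite R \<Longrightarrow> R \<subseteq> row T \<Longrightarrow> card R = (\<Sum>B \<in> set Bs. card (R \<inter> row B))"
    and "finite S \<Longrightarrow> S \<subseteq> col T \<Longrightarrow> card S = (\<Sum>B \<in> set Bs. card (S \<inter> col B))"
  using btf_partition_Union[OF assms] btf_partition_disjoint[OF assms]
  by (simp_all add: card_eq_sum_blocks)

lemma btf_partition_card_brick:
  assumes "btf_partition G T Bs" "finite (row T)" "finite (col T)"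
  shows "card (row T) = (\<Sum>B \<in> set Bs. card (row B))"
    and "card (col T) = (\<Sum>B \<in> set Bs. card (col B))"
proof -
  have "row T \<inter> row B = row B" "col T \<inter> col B = col B" if "B \<in> set Bs" for B
    using btf_partition_subset[OF assms(1) that] by auto
  then show "card (row T) = (\<Sum>B \<in> set Bs. card (row B))"
    "card (col T) = (\<Sum>B \<in> set Bs. card (col B))"
    using btf_partition_card[OF assms(1)] assms(2,3) by simp_all
qed

subsection \<open>Uniqueness\<close>

text \<open>The quantity of Hall's condition, whose maximum is the Hall deficiency of the columns.
  The inverse relation appears because dots are stored with the row first.\<close>

definition surplus :: "('r \<times> 'c) set \<Rightarrow> 'c set \<Rightarrow> int" where
  "surplus G S = int (card S) - int (card (G\<inverse> `` S))"

text \<open>The maximisers depend on the graph alone, so whatever they determine is common to all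
  decompositions.\<close>

definition tight_sets :: "('r \<times> 'c) set \<Rightarrow> ('r, 'c) brick \<Rightarrow> 'c set set" where
  "tight_sets G T = {S. S \<subseteq> col T \<and> (\<forall>S' \<subseteq> col T. surplus G S' \<le> surplus G S)}"

text \<open>A candidate block described without any decomposition. Rows are sorted by the
  neighbourhoods of tight sets, since a row enters such a neighbourhood exactly when the columns of
  its block enter the tight set.\<close>

definition tight_class :: "('r \<times> 'c) set \<Rightarrow> ('r, 'c) brick \<Rightarrow> 'c \<Rightarrow> ('r, 'c) brick" where
  "tight_class G T x = Brick
     {y \<in> row T. \<forall>M \<in> tight_sets G T. y \<in> G\<inverse> `` M \<longleftrightarrow> x \<in> M}
     {x' \<in> col T. \<forall>M \<in> tight_sets G T. x' \<in> M \<longleftrightarrow> x \<in> M}"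

locale bipartite_grid =
  fixes G :: "('r \<times> 'c) set" and T :: "('r, 'c) brick"
  assumes grid: "tall_grid G T"
begin

lemma finite_row: "finite (row T)" and finite_col: "finite (col T)"
  and row_nonempty: "row T \<noteq> {}" and col_nonempty: "col T \<noteq> {}"
  and edges: "G \<subseteq> row T \<times> col T" and tall: "card (col T) \<le> card (row T)"
  using grid by (auto simp: tall_grid_def)

lemma col_covered: "x \<in> col T \<Longrightarrow> \<exists>y. (y, x) \<in> G"
  and row_covered: "y \<in> row T \<Longrightarrow> \<exists>x. (y, x) \<in> G"
  using grid by (auto simp: tall_grid_def)

lemma neighbours_subset: "G\<inverse> `` S \<subseteq> row T"
  using edges by auto

lemma finite_neighbours: "finite (G\<inverse> `` S)"
  using finite_row neighbours_subset by (rule finite_subset[rotated])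

end

section \<open>Blocks of a given decomposition and their tight sets\<close>

locale decomposed_grid = bipartite_grid G T
  for G :: "('r \<times> 'c) set" and T :: "('r, 'c) brick" +
  fixes d :: "('r, 'c) decomposition"
  assumes decomp: "excessive_decomposition G T d"
begin

lemma btf: "btf_partition G T (blocks d)"
  using decomp by (simp add: excessive_decomposition_def)

lemmas block_subset = btf_partition_subset[OF btf]
  and block_nonempty = btf_partition_nonempty[OF btf]
  and block_disjoint = btf_partition_disjoint[OF btf]

lemma block_finite:
  assumes "B \<in> set (blocks d)"
  shows "finite (row B)" "finite (col B)"
  using block_subset[OF assms] finite_row finite_col by (auto intro: finite_subset)

lemma block_excessive: "B \<in> set (blocks d) \<Longrightarrow> excessive G B \<and> \<not> dot_free G B"
  using decomp by (simp add: excessive_decomposition_def)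

lemma D_horizontal: "D_block d = Some B \<Longrightarrow> horizontal B"
  and C_balanced: "B \<in> set (C_blocks d) \<Longrightarrow> balanced B"
  and E_vertical: "E_block d = Some B \<Longrightarrow> vertical B"
  using decomp by (auto simp: excessive_decomposition_def)

text \<open>Only \<open>D\<close> is horizontal and it stands first; only \<open>E\<close> is
  vertical and it stands last.\<close>

lemma block_order:
  assumes "j < i" "i < length (blocks d)"
  shows "\<not> vertical (blocks d ! j)" "\<not> horizontal (blocks d ! i)"
proof -
  have "sorted_wrt (\<lambda>B B'. \<not> vertical B \<and> \<not> horizontal B') (blocks d)"
  proof -
    have "sorted_wrt (\<lambda>B B'. \<not> vertical B \<and> \<not> horizontal B') (C_blocks d)"
      using C_balanced
      by (intro sorted_wrt_mono_rel[OF _ sorted_wrt_true])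
        (auto simp: balanced_def horizontal_def vertical_def)
    then show ?thesis
      using D_horizontal C_balanced E_vertical
      by (cases "D_block d"; cases "E_block d")
        (auto simp: blocks_def sorted_wrt_append balanced_def horizontal_def vertical_def)
  qed
  then show "\<not> vertical (blocks d ! j)" "\<not> horizontal (blocks d ! i)"
    using assms by (auto simp: sorted_wrt_iff_nth_less)
qed

text \<open>This is the shape that \<open>excessive_col_covered\<close> leaves out. A neighbour of
  \<open>x\<close> exists in the whole grid; block triangularity keeps it out of later blocks, and
  no block precedes a horizontal one.\<close>

lemma horizontal_block_col_covered:
  assumes "B \<in> set (blocks d)" "horizontal B" "x \<in> col B"
  shows "x \<in> G `` row B"
proof -
  obtain j where j: "j < length (blocks d)" "B = blocks d ! j"
    using assms(1) by (auto simp: in_set_conv_nth)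
  obtain y where y: "(y, x) \<in> G" using col_covered block_subset assms by blast
  then have "y \<in> row T" using edges by auto
  then obtain B' where B': "B' \<in> set (blocks d)" "y \<in> row B'"
    using btf_partition_Union(1)[OF btf] by blast
  then obtain i where i: "i < length (blocks d)" "B' = blocks d ! i"
    by (auto simp: in_set_conv_nth)
  have "\<not> j < i" using btf_partition_no_edge[OF btf _ i(1)] y B' i j assms(3) by blast
  moreover have "\<not> i < j" using block_order(2)[OF _ j(1)] assms(2) j by blast
  ultimately have "i = j" by simp
  then show ?thesis using y B' i j by blast
qed

text \<open>Dually, the neighbour cannot lie in an earlier block by block triangularity, and no
  block follows a vertical one.\<close>

lemma vertical_block_row_covered:
  assumes "B \<in> set (blocks d)" "vertical B" "y \<in> row B"
  shows "y \<in> G\<inverse> `` col B"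
proof -
  obtain i where i: "i < length (blocks d)" "B = blocks d ! i"
    using assms(1) by (auto simp: in_set_conv_nth)
  obtain x where x: "(y, x) \<in> G" using row_covered block_subset assms by blast
  then have "x \<in> col T" using edges by auto
  then obtain B' where B': "B' \<in> set (blocks d)" "x \<in> col B'"
    using btf_partition_Union(2)[OF btf] by blast
  then obtain j where j: "j < length (blocks d)" "B' = blocks d ! j"
    by (auto simp: in_set_conv_nth)
  have "\<not> j < i" using btf_partition_no_edge[OF btf _ i(1)] x B' i j assms(3) by blast
  moreover have "\<not> i < j" using block_order(1)[OF _ j(1)] assms(2) i by blast
  ultimately have "i = j" by simp
  then show ?thesis using x B' i j by blast
qed

lemma block_covered:
  assumes "B \<in> set (blocks d)"
  shows "col B \<subseteq> G `` row B" "row B \<subseteq> G\<inverse> `` col B"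
proof -
  note B = block_excessive[OF assms, THEN conjunct1] block_excessive[OF assms, THEN conjunct2]
    block_finite[OF assms]
  show "col B \<subseteq> G `` row B"
    using excessive_col_covered[OF B] horizontal_block_col_covered[OF assms] by blast
  show "row B \<subseteq> G\<inverse> `` col B"
    using excessive_row_covered[OF B] vertical_block_row_covered[OF assms] by blast
qed

lemma block_surplus:
  assumes "B \<in> set (blocks d)"
  shows "card (S \<inter> col B) + card (row B) \<le> card (G\<inverse> `` S \<inter> row B) + long B"
    and "card (S \<inter> col B) + card (row B) = card (G\<inverse> `` S \<inter> row B) + long B \<Longrightarrow>
      S \<inter> col B = {} \<and> G\<inverse> `` S \<inter> row B = {} \<or> col B \<subseteq> S \<and> row B \<subseteq> G\<inverse> `` S"
proof -
  \<comment> \<open>\<open>R\<close> sees only the columns of \<open>S\<close> inside the block.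
    Columns of \<open>S\<close> in other blocks may add neighbours in \<open>row B\<close>, which
    weakens the bound; equality forces that they add none.\<close>
  define R where "R = G\<inverse> `` (S \<inter> col B) \<inter> row B"
  have B: "excessive G B" using block_excessive[OF assms] by blast
  note e = excessive_surplus[OF B block_finite[OF assms] _ block_covered[OF assms] R_def]
  have sub: "R \<subseteq> G\<inverse> `` S \<inter> row B" by (auto simp: R_def)
  have fin: "finite (G\<inverse> `` S \<inter> row B)" using block_finite[OF assms] by simp
  have le: "card R \<le> card (G\<inverse> `` S \<inter> row B)" by (rule card_mono[OF fin sub])
  have le': "card (S \<inter> col B) + card (row B) \<le> card R + long B" by (rule e(1)) simp
  show "card (S \<inter> col B) + card (row B) \<le> card (G\<inverse> `` S \<inter> row B) + long B"
    using le le' by linarith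
  assume eq: "card (S \<inter> col B) + card (row B) = card (G\<inverse> `` S \<inter> row B) + long B"
  then have "card R = card (G\<inverse> `` S \<inter> row B)" using le le' by linarith
  then have "R = G\<inverse> `` S \<inter> row B" using card_subset_eq[OF fin sub] by simp
  moreover have "S \<inter> col B = {} \<and> R = {} \<or> S \<inter> col B = col B \<and> R = row B"
    by (rule e(2)) (use eq \<open>card R = _\<close> in simp_all)
  ultimately show "S \<inter> col B = {} \<and> G\<inverse> `` S \<inter> row B = {} \<or> col B \<subseteq> S \<and> row B \<subseteq> G\<inverse> `` S"
    by blast
qed

text \<open>Once the number of rows of \<open>T\<close> is subtracted, this turns out to be the
  maximum surplus.\<close>

definition total_long :: nat where
  "total_long = (\<Sum>B \<in> set (blocks d). long B)"

text \<open>The inequality of \<open>block_surplus\<close> is summed over the blocks. Equality of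
  the sums forces equality in every summand, hence the all-or-nothing alternative in each
  block.\<close>

lemma
  assumes "S \<subseteq> col T"
  shows card_le_total_long:
      "card S + card (row T) \<le> card (G\<inverse> `` S) + total_long"
    and total_long_tight: "card S + card (row T) = card (G\<inverse> `` S) + total_long \<Longrightarrow>
      B \<in> set (blocks d) \<Longrightarrow>
      S \<inter> col B = {} \<and> G\<inverse> `` S \<inter> row B = {} \<or> col B \<subseteq> S \<and> row B \<subseteq> G\<inverse> `` S"
proof -
  let ?l = "\<lambda>B. card (S \<inter> col B) + card (row B)"
  let ?r = "\<lambda>B. card (G\<inverse> `` S \<inter> row B) + long B"
  have "finite S" using assms finite_col by (rule finite_subset)
  then have l: "card S + card (row T) = sum ?l (set (blocks d))"
    using btf_partition_card[OF btf] assms btf_partition_card_brick[OF btf finite_row finite_col]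
    by (simp add: sum.distrib)
  have r: "card (G\<inverse> `` S) + total_long = sum ?r (set (blocks d))"
    using btf_partition_card(1)[OF btf finite_neighbours neighbours_subset]
    by (simp add: sum.distrib total_long_def)
  show "card S + card (row T) \<le> card (G\<inverse> `` S) + total_long"
    unfolding l r by (intro sum_mono block_surplus)
  assume "card S + card (row T) = card (G\<inverse> `` S) + total_long" and B: "B \<in> set (blocks d)"
  then have eq: "sum ?l (set (blocks d)) = sum ?r (set (blocks d))" using l r by simp
  have "?l B = ?r B"
  proof (rule ccontr)
    assume "?l B \<noteq> ?r B"
    then have "?l B < ?r B" using block_surplus(1)[OF B, of S] by linarith
    then have "sum ?l (set (blocks d)) < sum ?r (set (blocks d))"
      using B block_surplus(1) by (intro sum_strict_mono_ex1) auto
    with eq show False by simp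
  qed
  then show "S \<inter> col B = {} \<and> G\<inverse> `` S \<inter> row B = {} \<or> col B \<subseteq> S \<and> row B \<subseteq> G\<inverse> `` S"
    by (rule block_surplus(2)[OF B])
qed

text \<open>In the prefix \<open>long\<close> counts columns and in the rest it counts rows, so the
  bound of \<open>card_le_total_long\<close> is met as soon as the neighbours of the prefix columns
  stay in the prefix rows.\<close>

lemma prefix_tight:
  assumes "blocks d = Us @ Vs"
    and "\<And>B. B \<in> set Us \<Longrightarrow> \<not> vertical B" "\<And>B. B \<in> set Vs \<Longrightarrow> \<not> horizontal B"
  defines "S \<equiv> \<Union>B \<in> set Us. col B"
  shows "S \<subseteq> col T" "card S + card (row T) = card (G\<inverse> `` S) + total_long"
proof -
  let ?R = "\<Union>B \<in> set Us. row B"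
  show S: "S \<subseteq> col T" using block_subset assms(1) by (auto simp: S_def)
  have dist: "distinct (Us @ Vs)" using btf_partition_distinct[OF btf] assms(1) by simp
  \<comment> \<open>A row of a block behind the prefix has no edge back into the prefix
    columns.\<close>
  have sub: "G\<inverse> `` S \<subseteq> ?R"
  proof
    fix y assume "y \<in> G\<inverse> `` S"
    then obtain x B where x: "(y, x) \<in> G" "B \<in> set Us" "x \<in> col B" by (auto simp: S_def)
    obtain j where j: "j < length Us" "B = Us ! j" using x by (auto simp: in_set_conv_nth)
    have "y \<in> row T" using x edges by auto
    then obtain B' where B': "B' \<in> set (blocks d)" "y \<in> row B'"
      using btf_partition_Union(1)[OF btf] by blast
    then obtain i where i: "i < length (blocks d)" "B' = blocks d ! i"
      by (auto simp: in_set_conv_nth)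
    have "blocks d ! j = B" using j assms(1) by (simp add: nth_append)
    then have "\<not> j < i" using btf_partition_no_edge[OF btf _ i(1)] x B' i by blast
    then have "B' = Us ! i" using i j assms(1) by (simp add: nth_append)
    then show "y \<in> ?R" using B' j \<open>\<not> j < i\<close> by auto
  qed
  have finU: "finite ?R" using block_finite assms(1) by auto
  have "card (G\<inverse> `` S) \<le> card ?R" using card_mono[OF finU sub] .
  also have "\<dots> = (\<Sum>B \<in> set Us. card (row B))"
    using block_finite block_disjoint assms(1) by (intro card_UN_disjoint) auto
  finally have N: "card (G\<inverse> `` S) \<le> (\<Sum>B \<in> set Us. card (row B))" .
  have C: "card S = (\<Sum>B \<in> set Us. card (col B))"
    unfolding S_def using block_finite block_disjoint assms(1) by (intro card_UN_disjoint) auto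
  have split: "sum f (set (blocks d)) = sum f (set Us) + sum f (set Vs)"
    for f :: "('r, 'c) brick \<Rightarrow> nat"
    using dist assms(1) by (simp add: sum.union_disjoint)
  have "(\<Sum>B \<in> set Us. long B) = (\<Sum>B \<in> set Us. card (col B))"
    using assms(2) by (intro sum.cong) (force simp: long_def vertical_def)+
  moreover have "(\<Sum>B \<in> set Vs. long B) = (\<Sum>B \<in> set Vs. card (row B))"
    using assms(3) by (intro sum.cong) (force simp: long_def horizontal_def)+
  ultimately have "card (G\<inverse> `` S) + total_long \<le> card S + card (row T)"
    using N C unfolding total_long_def split
      btf_partition_card_brick(1)[OF btf finite_row finite_col] by simp
  then show "card S + card (row T) = card (G\<inverse> `` S) + total_long"
    using card_le_total_long[OF S] by linarith
qed

text \<open>Some set attains the upper bound on the surplus, so the maximisers are exactly the sets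
  that attain it.\<close>

lemma tight_iff:
  "M \<in> tight_sets G T \<longleftrightarrow> M \<subseteq> col T \<and> card M + card (row T) = card (G\<inverse> `` M) + total_long"
proof -
  \<comment> \<open>The columns of all blocks but \<open>E\<close> serve as the set attaining the
    bound.\<close>
  define Us where "Us = option_to_list (D_block d) @ C_blocks d"
  have "blocks d = Us @ option_to_list (E_block d)" by (simp add: blocks_def Us_def)
  moreover have "\<not> vertical B" if "B \<in> set Us" for B
    using that D_horizontal C_balanced
    by (cases "D_block d") (auto simp: Us_def horizontal_def balanced_def vertical_def)
  moreover have "\<not> horizontal B" if "B \<in> set (option_to_list (E_block d))" for B
    using that E_vertical by (cases "E_block d") (auto simp: horizontal_def vertical_def)
  ultimately have "\<exists>S0 \<subseteq> col T. card S0 + card (row T) = card (G\<inverse> `` S0) + total_long"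
    using prefix_tight[of Us] by metis
  then obtain S0 where S0: "S0 \<subseteq> col T"
    "card S0 + card (row T) = card (G\<inverse> `` S0) + total_long" by blast
  have le: "surplus G S \<le> int total_long - int (card (row T))" if "S \<subseteq> col T" for S
    using card_le_total_long[OF that] by (simp add: surplus_def)
  show ?thesis
  proof
    assume M: "M \<in> tight_sets G T"
    then have "surplus G S0 \<le> surplus G M" "M \<subseteq> col T" using S0 by (auto simp: tight_sets_def)
    then show "M \<subseteq> col T \<and> card M + card (row T) = card (G\<inverse> `` M) + total_long"
      using S0(2) card_le_total_long[of M] by (simp add: surplus_def)
  next
    assume M: "M \<subseteq> col T \<and> card M + card (row T) = card (G\<inverse> `` M) + total_long"
    then have "surplus G M = int total_long - int (card (row T))" by (simp add: surplus_def)
    then show "M \<in> tight_sets G T" using M le by (simp add: tight_sets_def)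
  qed
qed

lemma tight_block:
  assumes "M \<in> tight_sets G T" "B \<in> set (blocks d)"
  shows "M \<inter> col B = {} \<and> G\<inverse> `` M \<inter> row B = {} \<or> col B \<subseteq> M \<and> row B \<subseteq> G\<inverse> `` M"
proof (rule total_long_tight[OF _ _ assms(2)])
  show "M \<subseteq> col T" "card M + card (row T) = card (G\<inverse> `` M) + total_long"
    using assms(1) by (simp_all add: tight_iff)
qed

text \<open>Cut directly after block \<open>i\<close>. Every block up to \<open>i\<close> is
  followed by block \<open>j\<close>, so it is not vertical; every block after \<open>i\<close> is
  preceded by block \<open>i\<close>, so it is not horizontal. Hence the prefix is tight.\<close>

lemma prefix_separates:
  assumes "i < j" "j < length (blocks d)"
  obtains M where "M \<in> tight_sets G T" "col (blocks d ! i) \<subseteq> M" "M \<inter> col (blocks d ! j) = {}"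
proof
  let ?Us = "take (Suc i) (blocks d)"
  let ?M = "\<Union>B \<in> set ?Us. col B"
  have "\<not> vertical B" if B: "B \<in> set ?Us" for B
  proof -
    obtain k where "k < Suc i" "B = blocks d ! k"
      using B assms by (auto simp: in_set_conv_nth)
    then show ?thesis using block_order(1)[of k j] assms by simp
  qed
  moreover have "\<not> horizontal B" if B: "B \<in> set (drop (Suc i) (blocks d))" for B
  proof -
    obtain k where "k < length (drop (Suc i) (blocks d))" "B = drop (Suc i) (blocks d) ! k"
      using B unfolding in_set_conv_nth by blast
    then have "Suc i + k < length (blocks d)" "B = blocks d ! (Suc i + k)" by auto
    then show ?thesis using block_order(2)[of i "Suc i + k"] assms by simp
  qed
  ultimately show "?M \<in> tight_sets G T"
    using prefix_tight[of ?Us "drop (Suc i) (blocks d)"] unfolding tight_iff by simp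
  have "blocks d ! i \<in> set ?Us" using assms by (auto simp: in_set_conv_nth)
  then show "col (blocks d ! i) \<subseteq> ?M" by blast
  have "B \<noteq> blocks d ! j" if B: "B \<in> set ?Us" for B
  proof -
    obtain k where "k < Suc i" "B = blocks d ! k"
      using B assms by (auto simp: in_set_conv_nth)
    then show ?thesis
      using btf_partition_distinct[OF btf] assms by (simp add: nth_eq_iff_index_eq)
  qed
  then show "?M \<inter> col (blocks d ! j) = {}"
    using block_disjoint(2)[OF in_set_takeD nth_mem[OF assms(2)]] by blast
qed

text \<open>Tight sets never cut a block, which gives one inclusion for rows and for columns. For
  the other, the block of a vertex in the class agrees with \<open>B\<close> on all tight sets, and
  distinct blocks are separated by one.\<close>

lemma block_eq_tight_class:
  assumes B: "B \<in> set (blocks d)" and x: "x \<in> col B"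
  shows "B = tight_class G T x"
proof -
  \<comment> \<open>A separating prefix exists for either order of the two blocks, so agreement on
    all tight sets leaves only equality.\<close>
  have sep: "B' = B" if B': "B' \<in> set (blocks d)"
    and same: "\<And>M. M \<in> tight_sets G T \<Longrightarrow> col B' \<subseteq> M \<longleftrightarrow> x \<in> M" for B'
  proof -
    obtain i j where ij: "i < length (blocks d)" "B = blocks d ! i"
      "j < length (blocks d)" "B' = blocks d ! j"
      using B B' by (auto simp: in_set_conv_nth)
    have ne: "col B' \<noteq> {}" using block_nonempty B' by blast
    have "\<not> i < j"
    proof
      assume "i < j"
      from prefix_separates[OF this ij(3)] obtain M where
        M: "M \<in> tight_sets G T" "col B \<subseteq> M" "M \<inter> col B' = {}" unfolding ij(2,4) .
      then show False using same[OF M(1)] ne x by blast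
    qed
    moreover have "\<not> j < i"
    proof
      assume "j < i"
      from prefix_separates[OF this ij(1)] obtain M where
        M: "M \<in> tight_sets G T" "col B' \<subseteq> M" "M \<inter> col B = {}" unfolding ij(2,4) .
      then show False using same[OF M(1)] x by blast
    qed
    ultimately show "B' = B" using ij by simp
  qed
  have "row B = {y \<in> row T. \<forall>M \<in> tight_sets G T. y \<in> G\<inverse> `` M \<longleftrightarrow> x \<in> M}" (is "_ = ?R")
  proof
    show "row B \<subseteq> ?R"
    proof
      fix y assume y: "y \<in> row B"
      have "y \<in> G\<inverse> `` M \<longleftrightarrow> x \<in> M" if "M \<in> tight_sets G T" for M
        using tight_block[OF that B] x y by blast
      then show "y \<in> ?R" using y block_subset[OF B] by blast
    qed
    show "?R \<subseteq> row B"
    proof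
      fix y assume y: "y \<in> ?R"
      then have "y \<in> (\<Union>B \<in> set (blocks d). row B)"
        unfolding btf_partition_Union(1)[OF btf] by simp
      then obtain B' where B': "B' \<in> set (blocks d)" "y \<in> row B'" by blast
      have "col B' \<subseteq> M \<longleftrightarrow> x \<in> M" if M: "M \<in> tight_sets G T" for M
      proof -
        have "y \<in> G\<inverse> `` M \<longleftrightarrow> x \<in> M" using y M by simp
        then show ?thesis using tight_block[OF M B'(1)] block_nonempty(2)[OF B'(1)] B'(2) by blast
      qed
      then have "B' = B" by (rule sep[OF B'(1)])
      then show "y \<in> row B" using B'(2) by simp
    qed
  qed
  moreover have "col B = {x' \<in> col T. \<forall>M \<in> tight_sets G T. x' \<in> M \<longleftrightarrow> x \<in> M}" (is "_ = ?S")
  proof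
    show "col B \<subseteq> ?S"
    proof
      fix x' assume x': "x' \<in> col B"
      have "x' \<in> M \<longleftrightarrow> x \<in> M" if "M \<in> tight_sets G T" for M
        using tight_block[OF that B] x x' by blast
      then show "x' \<in> ?S" using x' block_subset[OF B] by blast
    qed
    show "?S \<subseteq> col B"
    proof
      fix x' assume x': "x' \<in> ?S"
      then have "x' \<in> (\<Union>B \<in> set (blocks d). col B)"
        unfolding btf_partition_Union(2)[OF btf] by simp
      then obtain B' where B': "B' \<in> set (blocks d)" "x' \<in> col B'" by blast
      have "col B' \<subseteq> M \<longleftrightarrow> x \<in> M" if M: "M \<in> tight_sets G T" for M
      proof -
        have "x' \<in> M \<longleftrightarrow> x \<in> M" using x' M by simp
        then show ?thesis using tight_block[OF M B'(1)] B'(2) by blast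
      qed
      then have "B' = B" by (rule sep[OF B'(1)])
      then show "x' \<in> col B" using B'(2) by simp
    qed
  qed
  ultimately show ?thesis by (cases B) (simp add: tight_class_def)
qed

text \<open>The right-hand side does not mention \<open>d\<close>; this is the core of
  uniqueness.\<close>

lemma set_blocks_eq: "set (blocks d) = tight_class G T ` col T"
proof
  show "set (blocks d) \<subseteq> tight_class G T ` col T"
  proof
    fix B assume B: "B \<in> set (blocks d)"
    then obtain x where x: "x \<in> col B" using block_nonempty(2) by blast
    then show "B \<in> tight_class G T ` col T"
      using block_eq_tight_class[OF B x] block_subset(2)[OF B] by blast
  qed
  show "tight_class G T ` col T \<subseteq> set (blocks d)"
  proof
    fix B assume "B \<in> tight_class G T ` col T"
    then obtain x where x: "x \<in> col T" "B = tight_class G T x" by blast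
    then obtain B' where "B' \<in> set (blocks d)" "x \<in> col B'"
      using btf_partition_Union(2)[OF btf] by blast
    then show "B \<in> set (blocks d)" using block_eq_tight_class x(2) by simp
  qed
qed

lemma D_block_iff: "D_block d = Some B \<longleftrightarrow> B \<in> set (blocks d) \<and> horizontal B"
  and C_blocks_iff: "B \<in> set (C_blocks d) \<longleftrightarrow> B \<in> set (blocks d) \<and> balanced B"
  and E_block_iff: "E_block d = Some B \<longleftrightarrow> B \<in> set (blocks d) \<and> vertical B"
  using D_horizontal C_balanced E_vertical
  by (cases "D_block d"; cases "E_block d";
      force simp: blocks_def horizontal_def balanced_def vertical_def)+

lemma distinct_C_blocks: "distinct (C_blocks d)"
  using btf_partition_distinct[OF btf] by (simp add: blocks_def)

end

text \<open>The set of blocks is determined by the graph, and the shape of a block tells its role.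
  Multisets are compared because the order of the \<open>C\<close>-blocks may vary; distinctness
  lifts equality of sets to them.\<close>

lemma excessive_decomposition_unique:
  assumes "tall_grid G T" "excessive_decomposition G T d" "excessive_decomposition G T d'"
  shows "D_block d = D_block d'" "mset (C_blocks d) = mset (C_blocks d')" "E_block d = E_block d'"
proof -
  interpret d: decomposed_grid G T d using assms by unfold_locales
  interpret d': decomposed_grid G T d' using assms by unfold_locales
  have eq: "set (blocks d) = set (blocks d')" using d.set_blocks_eq d'.set_blocks_eq by simp
  have "D_block d = Some B \<longleftrightarrow> D_block d' = Some B" "E_block d = Some B \<longleftrightarrow> E_block d' = Some B" for B
    using d.D_block_iff d'.D_block_iff d.E_block_iff d'.E_block_iff eq by simp_all
  then show "D_block d = D_block d'" "E_block d = E_block d'" by (metis option.exhaust)+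
  have "set (C_blocks d) = set (C_blocks d')" using d.C_blocks_iff d'.C_blocks_iff eq by blast
  then show "mset (C_blocks d) = mset (C_blocks d')"
    using d.distinct_C_blocks d'.distinct_C_blocks by (simp add: set_eq_iff_mset_eq_distinct)
qed

subsection \<open>Existence\<close>

text \<open>The block by which a chain of column sets grows from \<open>M\<close> to
  \<open>M'\<close>, with the neighbours gained on the way as its rows.\<close>

definition gap :: "('r \<times> 'c) set \<Rightarrow> 'c set \<Rightarrow> 'c set \<Rightarrow> ('r, 'c) brick" where
  "gap G M M' = Brick (G\<inverse> `` M' - G\<inverse> `` M) (M' - M)"

lemma row_gap [simp]: "row (gap G M M') = G\<inverse> `` M' - G\<inverse> `` M"
  and col_gap [simp]: "col (gap G M M') = M' - M"
  by (simp_all add: gap_def)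

lemma gap_not_dot_free: "row (gap G M M') \<noteq> {} \<Longrightarrow> \<not> dot_free G (gap G M M')"
  by (auto simp: dot_free_def)

context bipartite_grid
begin

lemma neighbours_col: "G\<inverse> `` col T = row T"
  using row_covered edges by blast

lemma finite_subset_col: "S \<subseteq> col T \<Longrightarrow> finite S"
  using finite_col by (rule rev_finite_subset)

text \<open>Together the two equations say that columns minus rows of the gap is the gain in
  surplus, which decides its shape. Integers avoid truncated differences.\<close>

lemma card_gap:
  assumes "M \<subseteq> M'" "M' \<subseteq> col T"
  shows "int (card (row (gap G M M'))) = int (card (G\<inverse> `` M')) - int (card (G\<inverse> `` M))"
    and "int (card (col (gap G M M'))) = int (card M') - int (card M)"
proof -
  have "G\<inverse> `` M \<subseteq> G\<inverse> `` M'" using assms(1) by blast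
  then show "int (card (row (gap G M M'))) = int (card (G\<inverse> `` M')) - int (card (G\<inverse> `` M))"
    using finite_neighbours by (simp add: card_Diff_subset card_mono of_nat_diff)
  have "finite M" "finite M'" using assms finite_subset_col by blast+
  then show "int (card (col (gap G M M'))) = int (card M') - int (card M)"
    using assms by (simp add: card_Diff_subset card_mono of_nat_diff)
qed

text \<open>Adding the columns of a hole to \<open>M\<close> gives a set \<open>S\<close> strictly
  between \<open>M\<close> and \<open>M'\<close>, and the rows of the hole avoid its neighbours.
  With \<open>c\<close> the number of neighbours of \<open>M'\<close> minus \<open>card M\<close>,
  the hole has at most \<open>c + surplus G S\<close> vertices, while \<open>long\<close> of the gap
  is \<open>c + max (surplus G M) (surplus G M')\<close>.\<close>

lemma gap_excessive:
  assumes sub: "M \<subseteq> M'" "M' \<subseteq> col T" and ne: "row (gap G M M') \<noteq> {}"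
    and less: "\<And>S. M \<subset> S \<Longrightarrow> S \<subset> M' \<Longrightarrow> surplus G S < max (surplus G M) (surplus G M')"
  shows "excessive G (gap G M M')"
proof (rule excessiveI)
  show "finite (row (gap G M M'))" using finite_neighbours by simp
  show "finite (col (gap G M M'))" using finite_subset_col[OF sub(2)] by simp
  show "row (gap G M M') \<noteq> {}" by (fact ne)
  fix H assume H: "hole G (gap G M M') H"
  define S where "S = M \<union> col H"
  have S: "M \<subset> S" "S \<subset> M'" using H sub by (auto simp: hole_def S_def)
  have fin: "finite M" "finite (col H)"
    using S sub by (auto simp: S_def intro!: finite_subset_col)
  have "row H \<subseteq> G\<inverse> `` M' - G\<inverse> `` S"
    using H by (auto simp: hole_def dot_free_def S_def)
  moreover have "G\<inverse> `` S \<subseteq> G\<inverse> `` M'" using S by blast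
  ultimately have "card (row H) + card (G\<inverse> `` S) \<le> card (G\<inverse> `` M')"
    using card_mono[of "G\<inverse> `` M' - G\<inverse> `` S" "row H"] finite_neighbours
    by (simp add: card_Diff_subset card_mono le_diff_conv2)
  moreover have "card S = card M + card (col H)"
    unfolding S_def using fin H by (intro card_Un_disjoint) (auto simp: hole_def)
  ultimately have "int (vcount H) < max (int (card (row (gap G M M')))) (int (card (col (gap G M M'))))"
    unfolding card_gap[OF sub] using less[OF S] by (simp add: vcount_def surplus_def)
  then show "vcount H < long (gap G M M')" by (simp add: long_def)
qed

lemma tight_sets_nonempty: "tight_sets G T \<noteq> {}"
proof -
  have fin: "finite (surplus G ` Pow (col T))" using finite_col by simp
  moreover have "surplus G ` Pow (col T) \<noteq> {}" by blast
  ultimately have "Max (surplus G ` Pow (col T)) \<in> surplus G ` Pow (col T)" by (rule Max_in)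
  then obtain S where "S \<subseteq> col T" "surplus G S = Max (surplus G ` Pow (col T))" by auto
  then have "S \<in> tight_sets G T" using Max_ge[OF fin] by (simp add: tight_sets_def)
  then show ?thesis by blast
qed

lemma tight_subset: "M \<in> tight_sets G T \<Longrightarrow> M \<subseteq> col T"
  and tight_le: "M \<in> tight_sets G T \<Longrightarrow> S \<subseteq> col T \<Longrightarrow> surplus G S \<le> surplus G M"
  by (simp_all add: tight_sets_def)

lemma tight_less:
  assumes "M \<in> tight_sets G T" "S \<subseteq> col T" "S \<notin> tight_sets G T"
  shows "surplus G S < surplus G M"
proof -
  obtain S' where "S' \<subseteq> col T" "surplus G S < surplus G S'"
    using assms(2,3) by (auto simp: tight_sets_def not_le)
  then show ?thesis using tight_le[OF assms(1), of S'] by simp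
qed

text \<open>Induction on the columns outside \<open>M\<close>. A next larger tight set has the same
  surplus and splits off a balanced block; if none is left, all remaining columns form the vertical
  block, or there are none.\<close>

lemma tail_decomposition:
  assumes "M \<in> tight_sets G T"
  shows "\<exists>Cs e. btf_partition G (gap G M (col T)) (Cs @ option_to_list e) \<and>
    (\<forall>B \<in> set (Cs @ option_to_list e). excessive G B \<and> \<not> dot_free G B) \<and>
    (\<forall>B \<in> set Cs. balanced B) \<and> (\<forall>B \<in> set_option e. vertical B)"
  using assms
proof (induction "card (col T - M)" arbitrary: M rule: less_induct)
  case less
  note M = tight_subset[OF less.prems]
  show ?case
  proof (cases "\<exists>M' \<in> tight_sets G T. M \<subset> M'")
    case True
    then obtain M0 where "M0 \<in> tight_sets G T \<and> M \<subset> M0" by blast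
    \<comment> \<open>Least cardinality ensures that no tight set lies strictly between
      \<open>M\<close> and \<open>M'\<close>.\<close>
    from ex_has_least_nat[of "\<lambda>S. S \<in> tight_sets G T \<and> M \<subset> S", OF this, of card]
    obtain M' where M': "M' \<in> tight_sets G T" "M \<subset> M'"
      and min: "\<And>S. S \<in> tight_sets G T \<Longrightarrow> M \<subset> S \<Longrightarrow> card M' \<le> card S"
      by (elim exE conjE) simp
    note M'T = tight_subset[OF M'(1)]
    let ?B = "gap G M M'"
    have "surplus G M = surplus G M'"
      using tight_le[OF less.prems M'T] tight_le[OF M'(1) M] by simp
    then have bal: "balanced ?B"
      using card_gap[OF psubset_imp_subset[OF M'(2)] M'T]
      by (simp add: balanced_def surplus_def del: row_gap col_gap)
    have colB: "col ?B \<noteq> {}" using M' by auto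
    then have rowB: "row ?B \<noteq> {}"
      using bal finite_subset_col[OF M'T]
      by (metis balanced_def card.empty card_0_eq col_gap finite_Diff)
    have exc: "excessive G ?B"
    proof (rule gap_excessive)
      fix S assume S: "M \<subset> S" "S \<subset> M'"
      then have "card S < card M'" using finite_subset_col[OF M'T] by (simp add: psubset_card_mono)
      then have "S \<notin> tight_sets G T" using min S by force
      moreover have "S \<subseteq> col T" using S M'T by blast
      ultimately show "surplus G S < max (surplus G M) (surplus G M')"
        using tight_less[OF less.prems] by (simp add: less_max_iff_disj)
    qed (use M' M'T rowB in auto)
    have "card (col T - M') < card (col T - M)"
      using M' M'T finite_col by (intro psubset_card_mono) auto
    from less.hyps[OF this M'(1)] obtain Cs e where IH:
      "btf_partition G (gap G M' (col T)) (Cs @ option_to_list e)"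
      "\<forall>B \<in> set (Cs @ option_to_list e). excessive G B \<and> \<not> dot_free G B"
      "\<forall>B \<in> set Cs. balanced B" "\<forall>B \<in> set_option e. vertical B" by blast
    have "Brick (row (gap G M (col T)) - row ?B) (col (gap G M (col T)) - col ?B)
        = gap G M' (col T)"
      using M' by (auto simp: gap_def)
    then have "btf_partition G (gap G M (col T)) (?B # (Cs @ option_to_list e))"
      using IH(1) rowB colB M'T by (intro btf_partition_Cons) auto
    then show ?thesis
      using IH exc bal gap_not_dot_free[OF rowB] by (intro exI[of _ "?B # Cs"] exI[of _ e]) simp
  next
    case False
    show ?thesis
    proof (cases "M = col T")
      case True
      then show ?thesis
        by (intro exI[of _ "[]"] exI[of _ None]) (simp add: btf_partition_Nil)
    next
      case neq: False
      let ?B = "gap G M (col T)"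
      \<comment> \<open>\<open>S = col T\<close> is included: that case makes the block vertical,
        while the proper subsets make it excessive.\<close>
      have less': "surplus G S < surplus G M" if "M \<subset> S" "S \<subseteq> col T" for S
        using that False by (intro tight_less[OF less.prems]) auto
      have vert: "vertical ?B"
        using card_gap[OF M order.refl] less'[of "col T"] M neq
        by (simp add: vertical_def surplus_def psubset_eq del: row_gap col_gap)
      have colB: "col ?B \<noteq> {}" using M neq by auto
      have rowB: "row ?B \<noteq> {}" using vert by (auto simp: vertical_def simp del: row_gap col_gap)
      have "excessive G ?B"
        using M rowB less' by (intro gap_excessive) (auto simp: less_max_iff_disj)
      moreover have "btf_partition G ?B [?B]"
        using rowB colB by (simp add: btf_partition_single del: row_gap col_gap)
      ultimately show ?thesis using vert gap_not_dot_free[OF rowB]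
        by (intro exI[of _ "[]"] exI[of _ "Some ?B"]) simp
    qed
  qed
qed

text \<open>The chain starts at a tight set of least cardinality. If it is empty there is no
  \<open>D\<close>; otherwise the empty set is not tight, so the surplus of \<open>M\<close> is
  positive and the gap up to \<open>M\<close> is horizontal.\<close>

lemma ex_excessive_decomposition: "\<exists>d. excessive_decomposition G T d"
proof -
  obtain M0 where "M0 \<in> tight_sets G T" using tight_sets_nonempty by blast
  from ex_has_least_nat[of "\<lambda>S. S \<in> tight_sets G T", OF this, of card]
  obtain M where M: "M \<in> tight_sets G T"
    and min: "\<And>S. S \<in> tight_sets G T \<Longrightarrow> card M \<le> card S"
    by (elim exE conjE) simp
  note MT = tight_subset[OF M]
  obtain Cs e where tail:
    "btf_partition G (gap G M (col T)) (Cs @ option_to_list e)"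
    "\<forall>B \<in> set (Cs @ option_to_list e). excessive G B \<and> \<not> dot_free G B"
    "\<forall>B \<in> set Cs. balanced B" "\<forall>B \<in> set_option e. vertical B"
    using tail_decomposition[OF M] by blast
  show ?thesis
  proof (cases "M = {}")
    case True
    then have "gap G M (col T) = T" by (cases T) (use neighbours_col in \<open>simp add: gap_def\<close>)
    then show ?thesis using tail
      by (intro exI[of _ "Decomposition None Cs e"]) (simp add: excessive_decomposition_def blocks_def)
  next
    case False
    let ?B = "gap G {} M"
    have notin: "S \<notin> tight_sets G T" if "S \<subset> M" for S
      using psubset_card_mono[OF finite_subset_col[OF MT] that] min[of S] by auto
    have less: "surplus G S < surplus G M" if "S \<subset> M" for S
      using tight_less[OF M _ notin[OF that]] that MT by blast
    have hor: "horizontal ?B"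
      using less[of "{}"] False by (auto simp: horizontal_def surplus_def)
    have colB: "col ?B \<noteq> {}" using False by simp
    have rowB: "row ?B \<noteq> {}" using False MT col_covered by fastforce
    have exc: "excessive G ?B"
      using MT rowB less by (intro gap_excessive) (auto simp: less_max_iff_disj)
    have "Brick (row T - row ?B) (col T - col ?B) = gap G M (col T)"
      using neighbours_col by (simp add: gap_def)
    then have "btf_partition G T (?B # (Cs @ option_to_list e))"
      using tail(1) rowB colB MT neighbours_subset by (intro btf_partition_Cons) auto
    then show ?thesis using tail exc hor gap_not_dot_free[OF rowB]
      by (intro exI[of _ "Decomposition (Some ?B) Cs e"])
        (simp add: excessive_decomposition_def blocks_def)
  qed
qed

end

subsection \<open>Characteristic and block composition\<close>

context decomposed_grid
begin

lemma long_grid: "long T = card (row T)"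
  using tall by (simp add: long_def)

text \<open>Block triangularity keeps the other rows away from the columns of the first block. A
  second block \<open>B'\<close> makes this brick proper in both directions.\<close>

lemma first_block_hole:
  assumes "blocks d = B # B' # Bs"
  shows "hole G T (Brick (row T - row B) (col B))"
    and "vcount (Brick (row T - row B) (col B)) + card (row B) = card (row T) + card (col B)"
proof -
  have B: "B \<in> set (blocks d)" "B' \<in> set (blocks d)" "B \<noteq> B'"
    using assms btf_partition_distinct[OF btf] by auto
  note disj = block_disjoint[OF B] and sub = block_subset[OF B(1)] block_subset[OF B(2)]
    and ne = block_nonempty[OF B(1)] block_nonempty[OF B(2)]
  have "(y, x) \<notin> G" if y: "y \<in> row T - row B" and x: "x \<in> col B" for y x
  proof -
    obtain C where C: "C \<in> set (blocks d)" "y \<in> row C"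
      using y unfolding btf_partition_Union(1)[OF btf, symmetric] by blast
    then obtain i where i: "i < length (blocks d)" "C = blocks d ! i"
      by (auto simp: in_set_conv_nth)
    have "i \<noteq> 0" using i C y assms by (auto intro: ccontr)
    then show ?thesis
      using btf_partition_no_edge[OF btf _ i(1), of 0] C x i assms by simp
  qed
  then have "dot_free G (Brick (row T - row B) (col B))" by (auto simp: dot_free_def)
  moreover have "row T - row B \<noteq> {}" "col B \<noteq> col T" using disj sub(3,4) ne(3,4) by blast+
  ultimately show "hole G T (Brick (row T - row B) (col B))"
    using sub(1,2) ne(1,2) by (auto simp: hole_def)
  show "vcount (Brick (row T - row B) (col B)) + card (row B) = card (row T) + card (col B)"
    using sub block_finite[OF B(1)] card_mono[OF finite_row sub(1)]
    by (simp add: vcount_def card_Diff_subset)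
qed

lemma single_block: "blocks d = [B] \<Longrightarrow> T = B"
  using btf by (simp add: btf_partition_single)

lemma blocks_not_Nil: "blocks d \<noteq> []"
  using btf row_nonempty by (auto simp: btf_partition_Nil)

text \<open>Without \<open>D\<close> no block has more columns than rows, and only \<open>E\<close>
  has fewer; compare the sums over the blocks.\<close>

lemma no_D_balanced_iff:
  assumes "D_block d = None"
  shows "balanced T \<longleftrightarrow> E_block d = None"
proof -
  have le: "card (col B) \<le> card (row B)" if "B \<in> set (blocks d)" for B
    using D_block_iff[of B] assms that by (auto simp: horizontal_def)
  note cards = btf_partition_card_brick[OF btf finite_row finite_col]
  show ?thesis
  proof (cases "E_block d")
    case None
    have "card (col B) = card (row B)" if "B \<in> set (blocks d)" for B
      using E_block_iff[of B] None le[OF that] that by (auto simp: vertical_def)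
    then show ?thesis using None cards by (simp add: balanced_def)
  next
    case (Some B)
    then have "B \<in> set (blocks d)" "card (col B) < card (row B)"
      using E_block_iff by (auto simp: vertical_def)
    then have "(\<Sum>B \<in> set (blocks d). card (col B)) < (\<Sum>B \<in> set (blocks d). card (row B))"
      using le by (intro sum_strict_mono_ex1) auto
    then show ?thesis using Some cards by (simp add: balanced_def)
  qed
qed

text \<open>The excess of columns in \<open>D\<close> must be made up by a vertical block, because
  the grid has at least as many rows as columns.\<close>

lemma D_imp_E:
  assumes "D_block d = Some B"
  shows "E_block d \<noteq> None"
proof
  assume E: "E_block d = None"
  have "card (row B) \<le> card (col B)" if "B \<in> set (blocks d)" for B
    using E_block_iff[of B] E that by (auto simp: vertical_def)
  moreover have "B \<in> set (blocks d)" "card (row B) < card (col B)"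
    using assms D_block_iff by (auto simp: horizontal_def)
  ultimately have "(\<Sum>B \<in> set (blocks d). card (row B)) < (\<Sum>B \<in> set (blocks d). card (col B))"
    by (intro sum_strict_mono_ex1) auto
  then show False
    using tall btf_partition_card_brick[OF btf finite_row finite_col] by simp
qed

lemma D_imp_Deficient:
  assumes "D_block d = Some B"
  shows "char_type_of G T = Deficient"
proof -
  obtain e where "E_block d = Some e" using D_imp_E[OF assms] by blast
  then obtain B' Bs where "blocks d = B # B' # Bs"
    using assms by (cases "C_blocks d") (auto simp: blocks_def)
  note h = first_block_hole[OF this]
  have "card (row B) < card (col B)" using D_horizontal[OF assms] by (simp add: horizontal_def)
  then have "long T < alpha_p G T"
    using vcount_le_alpha_p[OF finite_row finite_col h(1)] h(2) long_grid by linarith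
  then show ?thesis
    by (simp add: char_type_of_def excessive_def liminal_def characteristic_def)
qed

text \<open>Without \<open>D\<close>, \<open>total_long\<close> is the number of rows, so
  \<open>card_le_total_long\<close> becomes Hall's condition. The rows of a hole avoid the
  neighbours of its columns, which are at least as numerous as these columns.\<close>

lemma no_D_alpha_p_le:
  assumes "D_block d = None"
  shows "alpha_p G T \<le> long T"
proof (rule alpha_p_le[OF finite_row finite_col])
  fix H assume H: "hole G T H"
  have "long B = card (row B)" if "B \<in> set (blocks d)" for B
    using D_block_iff[of B] assms that by (auto simp: horizontal_def long_def)
  then have "total_long = card (row T)"
    using btf_partition_card_brick[OF btf finite_row finite_col] by (simp add: total_long_def)
  then have "card (col H) \<le> card (G\<inverse> `` col H)"
    using card_le_total_long[of "col H"] H by (auto simp: hole_def)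
  moreover have "row H \<subseteq> row T - G\<inverse> `` col H"
    using H by (auto simp: hole_def dot_free_def)
  then have "card (row H) \<le> card (row T - G\<inverse> `` col H)" using finite_row by (simp add: card_mono)
  moreover have "card (row T - G\<inverse> `` col H) + card (G\<inverse> `` col H) = card (row T)"
    using neighbours_subset finite_neighbours card_mono[OF finite_row neighbours_subset[of "col H"]]
    by (simp add: card_Diff_subset)
  ultimately show "vcount H \<le> long T" unfolding vcount_def long_grid by linarith
qed

lemma no_D_Liminal:
  assumes "D_block d = None" "blocks d = B # B' # Bs" "balanced B"
  shows "char_type_of G T = Liminal"
proof -
  note h = first_block_hole[OF assms(2)]
  have "long T \<le> alpha_p G T"
    using vcount_le_alpha_p[OF finite_row finite_col h(1)] h(2) long_grid assms(3)
    by (simp add: balanced_def)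
  then show ?thesis using no_D_alpha_p_le[OF assms(1)]
    by (simp add: char_type_of_def excessive_def liminal_def characteristic_def)
qed

lemma single_block_Excessive:
  assumes "blocks d = [B]"
  shows "char_type_of G T = Excessive"
  using block_excessive[of B] single_block[OF assms] assms by (simp add: char_type_of_def)

text \<open>A block \<open>D\<close> forces \<open>E\<close> and deficiency. Without it, a single
  block means excessive, and several blocks begin with a \<open>C\<close>-block and mean liminal;
  \<open>E\<close> then decides the imbalance.\<close>

lemma composition_in_table:
  "((imbalance_of T, char_type_of G T, count_class_of (length (C_blocks d))), composition_of d)
    \<in> set composition_table"
proof (cases "D_block d")
  case (Some B)
  then show ?thesis using D_imp_E[OF Some] D_imp_Deficient[OF Some]
    by (cases "imbalance_of T"; cases "count_class_of (length (C_blocks d))")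
      (auto simp: composition_of_def composition_table_def)
next
  case D: None
  note bal = no_D_balanced_iff[OF D]
  show ?thesis
  proof (cases "E_block d")
    case E: None
    show ?thesis
    proof (cases "C_blocks d")
      case Nil
      then show ?thesis using D E blocks_not_Nil by (simp add: blocks_def)
    next
      case C: (Cons B Cs)
      show ?thesis
      proof (cases Cs)
        case Nil
        then have "char_type_of G T = Excessive"
          using C D E by (intro single_block_Excessive) (simp add: blocks_def)
        then show ?thesis using C D E Nil bal
          by (simp add: composition_of_def composition_table_def imbalance_of_def count_class_of_def)
      next
        case (Cons B' Cs')
        then have "char_type_of G T = Liminal"
          using C D E C_balanced by (intro no_D_Liminal) (auto simp: blocks_def)
        then show ?thesis using C D E Cons bal
          by (simp add: composition_of_def composition_table_def imbalance_of_def count_class_of_def)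
      qed
    qed
  next
    case E: (Some e)
    show ?thesis
    proof (cases "C_blocks d")
      case Nil
      then have "char_type_of G T = Excessive"
        using D E by (intro single_block_Excessive) (simp add: blocks_def)
      then show ?thesis using D E Nil bal
        by (simp add: composition_of_def composition_table_def imbalance_of_def count_class_of_def)
    next
      case C: (Cons B Cs)
      obtain B' Bs where "blocks d = B # B' # Bs" using C D E by (cases Cs) (auto simp: blocks_def)
      then have "char_type_of G T = Liminal"
        using C D C_balanced by (intro no_D_Liminal) auto
      then show ?thesis using C D E bal
        by (simp add: composition_of_def composition_table_def imbalance_of_def count_class_of_def)
    qed
  qed
qed

end

section \<open>The triple as an invariant\<close>

lemma has_triple_eq:
  assumes "tall_grid G T" "excessive_decomposition G T d" "has_triple G T t"
  shows "t = (imbalance_of T, char_type_of G T, count_class_of (length (C_blocks d)))"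
proof -
  obtain d' where d': "excessive_decomposition G T d'"
    "t = (imbalance_of T, char_type_of G T, count_class_of (length (C_blocks d')))"
    using assms(3) by (auto simp: has_triple_def)
  have "mset (C_blocks d) = mset (C_blocks d')"
    by (rule excessive_decomposition_unique(2)[OF assms(1,2) d'(1)])
  then have "length (C_blocks d) = length (C_blocks d')" by (rule mset_eq_length)
  then show ?thesis using d'(2) by simp
qed

lemma tall_grid_decomposition_exists:
  assumes "tall_grid G T"
  obtains d where "excessive_decomposition G T d"
  using bipartite_grid.ex_excessive_decomposition[OF bipartite_grid.intro[OF assms]] that by blast

lemma has_triple_unique:
  assumes "tall_grid G T"
  shows "\<exists>!t. has_triple G T t"
proof -
  obtain d where d: "excessive_decomposition G T d"
    using tall_grid_decomposition_exists[OF assms] .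
  show ?thesis
  proof (rule ex1I)
    show "has_triple G T (imbalance_of T, char_type_of G T, count_class_of (length (C_blocks d)))"
      using d by (auto simp: has_triple_def)
  qed (rule has_triple_eq[OF assms d])
qed

lemma has_triple_in_table:
  assumes "tall_grid G T" "has_triple G T t" "excessive_decomposition G T d"
  shows "(t, composition_of d) \<in> set composition_table"
proof -
  interpret decomposed_grid G T d using assms by unfold_locales
  show ?thesis using composition_in_table has_triple_eq[OF assms(1,3,2)] by simp
qed

text \<open>A finite check. The imbalance accompanies the composition because deficient balanced and
  unbalanced entries share compositions.\<close>

lemma composition_table_functional:
  assumes "(t, c) \<in> set composition_table" "(t', c') \<in> set composition_table"
  shows "t = t' \<longleftrightarrow> fst t = fst t' \<and> c = c'"
  using assms unfolding composition_table_def by auto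

text \<open>The grid itself, as the only block, is a valid decomposition; uniqueness does the rest,
  since a multiset of at most one block fixes the list.\<close>

lemma excessive_grid_decomposition:
  assumes "tall_grid G T" "excessive G T" "excessive_decomposition G T d"
  shows "d = (if balanced T then Decomposition None [T] None else Decomposition None [] (Some T))"
proof -
  interpret bipartite_grid G T using assms by unfold_locales
  let ?d = "if balanced T then Decomposition None [T] None else Decomposition None [] (Some T)"
  have "\<not> dot_free G T" using edges row_covered row_nonempty by (fastforce simp: dot_free_def)
  moreover have "btf_partition G T [T]"
    using row_nonempty col_nonempty by (simp add: btf_partition_single)
  ultimately have "excessive_decomposition G T ?d"
    using assms(2) tall
    by (auto simp: excessive_decomposition_def blocks_def balanced_def vertical_def)
  from excessive_decomposition_unique[OF assms(1,3) this]
  show ?thesis by (cases d) (auto split: if_splits)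
qed

section \<open>Examples attaining the listed triples\<close>

definition complete_blocks :: "('r, 'c) decomposition \<Rightarrow> ('r \<times> 'c) set" where
  "complete_blocks d = (\<Union>B \<in> set (blocks d). row B \<times> col B)"

definition union_brick :: "('r, 'c) decomposition \<Rightarrow> ('r, 'c) brick" where
  "union_brick d = Brick (\<Union>B \<in> set (blocks d). row B) (\<Union>B \<in> set (blocks d). col B)"

text \<open>A complete brick has no holes, hence is excessive, and vertex-disjoint blocks have no
  edges between them, so block triangularity holds in any order.\<close>

lemma complete_blocks_decomposition:
  assumes ne: "blocks d \<noteq> []" and dist: "distinct (blocks d)"
    and fin: "\<forall>B \<in> set (blocks d). finite (row B) \<and> finite (col B) \<and> row B \<noteq> {} \<and> col B \<noteq> {}"
    and disj: "\<forall>B \<in> set (blocks d). \<forall>B' \<in> set (blocks d). B \<noteq> B' \<longrightarrow>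
      row B \<inter> row B' = {} \<and> col B \<inter> col B' = {}"
    and shape: "\<forall>B \<in> set_option (D_block d). horizontal B" "\<forall>B \<in> set (C_blocks d). balanced B"
      "\<forall>B \<in> set_option (E_block d). vertical B"
    and tall: "card (col (union_brick d)) \<le> card (row (union_brick d))"
  shows "tall_grid (complete_blocks d) (union_brick d)"
    and "excessive_decomposition (complete_blocks d) (union_brick d) d"
proof -
  let ?G = "complete_blocks d"
  obtain B0 where "B0 \<in> set (blocks d)" using ne by (meson last_in_set)
  then have "row (union_brick d) \<noteq> {}" "col (union_brick d) \<noteq> {}"
    using fin by (auto simp: union_brick_def)
  moreover have "\<exists>x \<in> col (union_brick d). (y, x) \<in> ?G" if y: "y \<in> row (union_brick d)" for y
  proof -
    obtain B where B: "B \<in> set (blocks d)" "y \<in> row B" using y by (auto simp: union_brick_def)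
    then obtain x where "x \<in> col B" using fin by blast
    then show ?thesis using B by (intro bexI[of _ x]) (auto simp: union_brick_def complete_blocks_def)
  qed
  moreover have "\<exists>y \<in> row (union_brick d). (y, x) \<in> ?G" if x: "x \<in> col (union_brick d)" for x
  proof -
    obtain B where B: "B \<in> set (blocks d)" "x \<in> col B" using x by (auto simp: union_brick_def)
    then obtain y where "y \<in> row B" using fin by blast
    then show ?thesis using B by (intro bexI[of _ y]) (auto simp: union_brick_def complete_blocks_def)
  qed
  moreover have "finite (row (union_brick d))" "finite (col (union_brick d))"
    using fin by (simp_all add: union_brick_def)
  moreover have "?G \<subseteq> row (union_brick d) \<times> col (union_brick d)"
    by (auto simp: union_brick_def complete_blocks_def)
  ultimately show "tall_grid ?G (union_brick d)"
    using tall unfolding tall_grid_def by blast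
  have "inj_on row (set (blocks d))" "inj_on col (set (blocks d))"
    using fin disj by (metis inf.idem inj_onI)+
  moreover have "disjoint (row ` set (blocks d))" "disjoint (col ` set (blocks d))"
    using disj by (fastforce intro!: disjointI)+
  moreover have "?G \<inter> row (blocks d ! i) \<times> col (blocks d ! j) = {}"
    if ij: "i < length (blocks d)" "j < i" for i j
  proof -
    have neq: "blocks d ! i \<noteq> blocks d ! j" using ij dist by (simp add: nth_eq_iff_index_eq)
    have mem: "blocks d ! i \<in> set (blocks d)" "blocks d ! j \<in> set (blocks d)" using ij by auto
    have "B = blocks d ! i" if "B \<in> set (blocks d)" "y \<in> row B" "y \<in> row (blocks d ! i)" for B y
      using disj mem(1) that by blast
    moreover have "B = blocks d ! j" if "B \<in> set (blocks d)" "x \<in> col B" "x \<in> col (blocks d ! j)" for B x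
      using disj mem(2) that by blast
    ultimately show ?thesis using neq unfolding complete_blocks_def by fast
  qed
  ultimately have "btf_partition ?G (union_brick d) (blocks d)"
    using dist fin by (auto simp: btf_partition_def distinct_map partition_on_def union_brick_def)
  moreover have "excessive ?G B \<and> \<not> dot_free ?G B" if B: "B \<in> set (blocks d)" for B
  proof
    have full: "row B \<times> col B \<subseteq> ?G" using B by (auto simp: complete_blocks_def)
    show "\<not> dot_free ?G B" using full fin B by (fastforce simp: dot_free_def)
    have "\<not> hole ?G B H" for H using full by (force simp: hole_def dot_free_def)
    then show "excessive ?G B" using fin B by (intro excessiveI) auto
  qed
  ultimately show "excessive_decomposition ?G (union_brick d) d"
    using shape by (simp add: excessive_decomposition_def)
qed

text \<open>The labels keep the blocks disjoint, with the \<open>C\<close>-blocks starting at 4.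
  \<open>E\<close> with two rows just offsets the extra column of \<open>D\<close>; its third row
  makes the grid unbalanced.\<close>

definition sample :: "imbalance \<Rightarrow> bool \<Rightarrow> nat \<Rightarrow> bool \<Rightarrow> (nat, nat) decomposition" where
  "sample i hasD k hasE = Decomposition
     (if hasD then Some (Brick {0} {0, 1}) else None)
     (map (\<lambda>n. Brick {n + 4} {n + 4}) [0..<k])
     (if hasE then Some (Brick (if i = Balanced then {1, 2} else {1, 2, 3}) {2}) else None)"

lemma table_entry_attained:
  assumes "(t, c) \<in> set composition_table"
  shows "(triple_class t :: ((nat \<times> nat) set \<times> (nat, nat) brick) set) \<noteq> {}"
proof -
  obtain i ch k0 hasD k hasE where tc: "t = (i, ch, k0)" "c = (hasD, k, hasE)"
    by (cases t; cases c)
  define d where "d = sample i hasD (case k of Zero \<Rightarrow> 0 | One \<Rightarrow> 1 | Many \<Rightarrow> 2) hasE"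
  let ?G = "complete_blocks d" and ?T = "union_brick d"
  \<comment> \<open>These consequences of membership in the table ensure that the sample is
    nonempty, tall and of imbalance \<open>i\<close>.\<close>
  have shape: "hasD \<longrightarrow> hasE" "k = Zero \<longrightarrow> hasE" "i = Unbalanced \<longrightarrow> hasE"
    "i = Balanced \<and> hasE \<longrightarrow> hasD"
    using assms unfolding tc by (auto simp: composition_table_def)
  note defs = d_def sample_def blocks_def union_brick_def horizontal_def balanced_def
    vertical_def imbalance_of_def composition_of_def count_class_of_def numeral_2_eq_2
  have "excessive_decomposition ?G ?T d \<and> tall_grid ?G ?T"
    by (intro conjI complete_blocks_decomposition; insert shape;
      cases i; cases hasD; cases k; cases hasE; simp add: defs)
  then have d: "tall_grid ?G ?T" "excessive_decomposition ?G ?T d" by simp_all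
  have d': "imbalance_of ?T = fst t" "composition_of d = c"
    unfolding tc using shape by (cases i; cases hasD; cases k; cases hasE; simp add: defs)+
  let ?t = "(imbalance_of ?T, char_type_of ?G ?T, count_class_of (length (C_blocks d)))"
  have t: "has_triple ?G ?T ?t" using d(2) by (auto simp: has_triple_def)
  \<comment> \<open>The characteristic is never computed: the imbalance and the composition already
    single out the table entry.\<close>
  have "?t = t"
    using composition_table_functional[OF has_triple_in_table[OF d(1) t d(2)] assms] d' by simp
  then have "(?G, ?T) \<in> triple_class t" using t d(1) by (simp add: triple_class_def)
  then show ?thesis by blast
qed

text \<open>Occurrence is expressed over \<open>nat\<close>, where there are enough vertices for the
  samples; an arbitrary type could be too small.\<close>

lemma nonempty_class_iff:
  "(triple_class t :: ((nat \<times> nat) set \<times> (nat, nat) brick) set) \<noteq> {} \<longleftrightarrow>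
    t \<in> fst ` set composition_table"
proof
  assume "(triple_class t :: ((nat \<times> nat) set \<times> (nat, nat) brick) set) \<noteq> {}"
  then obtain G :: "(nat \<times> nat) set" and T :: "(nat, nat) brick"
    where "(G, T) \<in> triple_class t" by (metis ex_in_conv surj_pair)
  then have GT: "tall_grid G T" "has_triple G T t" by (simp_all add: triple_class_def)
  obtain d where "excessive_decomposition G T d" using tall_grid_decomposition_exists[OF GT(1)] .
  from has_triple_in_table[OF GT this] show "t \<in> fst ` set composition_table"
    by (rule rev_image_eqI) simp
next
  assume "t \<in> fst ` set composition_table"
  then obtain c where "(t, c) \<in> set composition_table" by auto
  then show "(triple_class t :: ((nat \<times> nat) set \<times> (nat, nat) brick) set) \<noteq> {}"
    by (rule table_entry_attained)
qed

section \<open>Counting triples and the two laws\<close>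

lemma UNIV_triple:
  "(UNIV :: triple set) =
    {Balanced, Unbalanced} \<times> {Excessive, Liminal, Deficient} \<times> {Zero, One, Many}"
proof -
  have "(i, c, k) \<in> {Balanced, Unbalanced} \<times> {Excessive, Liminal, Deficient} \<times> {Zero, One, Many}"
    for i c k by (cases i; cases c; cases k) simp_all
  then show ?thesis by (metis UNIV_eq_I surj_pair)
qed

lemma lawful_iff: "t \<in> fst ` set composition_table \<longleftrightarrow> law_I t \<and> law_II t"
proof -
  obtain i c k where "t = (i, c, k)" by (cases t)
  then show ?thesis
    by (cases i; cases c; cases k) (simp_all add: composition_table_def)
qed

lemma card_table: "card (fst ` set composition_table) = 11"
  by (simp add: composition_table_def)

lemma card_UNIV_triple: "card (UNIV :: triple set) = 18"
  unfolding UNIV_triple by (simp add: card_cartesian_product)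

lemma card_unlawful: "card {t. \<not> law_I t \<or> \<not> law_II t} = 7"
proof -
  have "{t. \<not> law_I t \<or> \<not> law_II t} = UNIV - fst ` set composition_table"
    using lawful_iff by auto
  moreover have "finite (UNIV :: triple set)" using card_UNIV_triple card.infinite by fastforce
  ultimately show ?thesis
    using card_table card_UNIV_triple by (simp add: card_Diff_subset)
qed

text \<open>Law (II) for the abstract triple is translated back from count classes to the number of
  \<open>C\<close>-blocks.\<close>

lemma liminal_C_count:
  assumes "tall_grid G T" "excessive_decomposition G T d" "liminal G T"
  shows "length (C_blocks d) \<ge> 1 \<and> (balanced T \<longrightarrow> length (C_blocks d) \<ge> 2)"
proof -
  let ?t = "(imbalance_of T, char_type_of G T, count_class_of (length (C_blocks d)))"
  have "has_triple G T ?t" using assms(2) by (auto simp: has_triple_def)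
  from has_triple_in_table[OF assms(1) this assms(2)]
  have "?t \<in> fst ` set composition_table" by (rule rev_image_eqI) simp
  then have "law_II ?t" using lawful_iff by blast
  moreover have "char_type_of G T = Liminal"
    using assms(3) by (simp add: char_type_of_def excessive_def liminal_def)
  ultimately show ?thesis
    by (cases "length (C_blocks d)" rule: nat.exhaust)
      (auto simp: count_class_of_def imbalance_of_def Suc_le_eq split: if_splits)
qed

theorem theorem7p3:
  shows
    "(\<comment> \<open>the excessive decomposition, hence the triple, is well defined\<close>
      \<forall>(G :: ('r \<times> 'c) set) T0. tall_grid G T0 \<longrightarrow>
        (\<exists>d. excessive_decomposition G T0 d) \<and>
        (\<forall>d d'. excessive_decomposition G T0 d \<and> excessive_decomposition G T0 d' \<longrightarrow>
           D_block d = D_block d' \<and> mset (C_blocks d) = mset (C_blocks d') \<and>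
           E_block d = E_block d') \<and>
        (\<exists>!t. has_triple G T0 t)) \<and>
     (\<comment> \<open>distinct triples give disjoint classes\<close>
      \<forall>t t'. t \<noteq> t' \<longrightarrow>
        (triple_class t :: (('r \<times> 'c) set \<times> ('r, 'c) brick) set) \<inter> triple_class t' = {}) \<and>
     (\<comment> \<open>every occurring triple is listed and determines the block composition as indicated\<close>
      \<forall>(G :: ('r \<times> 'c) set) T0 t d.
        tall_grid G T0 \<and> has_triple G T0 t \<and> excessive_decomposition G T0 d \<longrightarrow>
        (t, composition_of d) \<in> set composition_table) \<and>
     (\<comment> \<open>of the 18 triples exactly the 11 listed ones occur\<close>
      card (UNIV :: triple set) = 18 \<and>
      card (fst ` set composition_table) = 11 \<and>
      {t. (triple_class t :: ((nat \<times> nat) set \<times> (nat, nat) brick) set) \<noteq> {}}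
        = fst ` set composition_table) \<and>
     (\<comment> \<open>the triple as a complete invariant of the block composition\<close>
      \<forall>(G :: ('r \<times> 'c) set) T0 t d (G' :: ('p \<times> 'q) set) T0' t' d'.
        tall_grid G T0 \<and> has_triple G T0 t \<and> excessive_decomposition G T0 d \<and>
        tall_grid G' T0' \<and> has_triple G' T0' t' \<and> excessive_decomposition G' T0' d' \<longrightarrow>
        (t = t' \<longleftrightarrow>
           imbalance_of T0 = imbalance_of T0' \<and> composition_of d = composition_of d')) \<and>
     (\<comment> \<open>the seven excluded triples are those violating one of the laws\<close>
      {t. (triple_class t :: ((nat \<times> nat) set \<times> (nat, nat) brick) set) = {}}
        = {t. \<not> law_I t \<or> \<not> law_II t} \<and>
      card {t. \<not> law_I t \<or> \<not> law_II t} = 7) \<and>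
     (\<comment> \<open>law (I)\<close>
      \<forall>(G :: ('r \<times> 'c) set) T0 d.
        tall_grid G T0 \<and> excessive_decomposition G T0 d \<and> excessive G T0 \<longrightarrow>
        d = (if balanced T0 then Decomposition None [T0] None
             else Decomposition None [] (Some T0))) \<and>
     (\<comment> \<open>law (II)\<close>
      \<forall>(G :: ('r \<times> 'c) set) T0 d.
        tall_grid G T0 \<and> excessive_decomposition G T0 d \<and> liminal G T0 \<longrightarrow>
        length (C_blocks d) \<ge> 1 \<and> (balanced T0 \<longrightarrow> length (C_blocks d) \<ge> 2))"
proof (intro conjI allI impI)
  fix G :: "('r \<times> 'c) set" and T0
  assume g: "tall_grid G T0"
  show "\<exists>d. excessive_decomposition G T0 d" using tall_grid_decomposition_exists[OF g] by blast
  show "\<exists>!t. has_triple G T0 t" by (rule has_triple_unique[OF g])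
  fix d d' assume "excessive_decomposition G T0 d \<and> excessive_decomposition G T0 d'"
  then show "D_block d = D_block d'" "mset (C_blocks d) = mset (C_blocks d')"
    "E_block d = E_block d'"
    using excessive_decomposition_unique[OF g] by blast+
next
  fix t t' :: triple assume "t \<noteq> t'"
  then show "(triple_class t :: (('r \<times> 'c) set \<times> ('r, 'c) brick) set) \<inter> triple_class t' = {}"
    using has_triple_unique by (fastforce simp: triple_class_def)
next
  fix G :: "('r \<times> 'c) set" and T0 t d
  assume "tall_grid G T0 \<and> has_triple G T0 t \<and> excessive_decomposition G T0 d"
  then show "(t, composition_of d) \<in> set composition_table" using has_triple_in_table by blast
next
  show "{t. (triple_class t :: ((nat \<times> nat) set \<times> (nat, nat) brick) set) \<noteq> {}}
      = fst ` set composition_table"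
    unfolding nonempty_class_iff by simp
next
  fix G :: "('r \<times> 'c) set" and T0 t d and G' :: "('p \<times> 'q) set" and T0' t' d'
  assume "tall_grid G T0 \<and> has_triple G T0 t \<and> excessive_decomposition G T0 d \<and>
    tall_grid G' T0' \<and> has_triple G' T0' t' \<and> excessive_decomposition G' T0' d'"
  then have a: "tall_grid G T0" "has_triple G T0 t" "excessive_decomposition G T0 d"
    and a': "tall_grid G' T0'" "has_triple G' T0' t'" "excessive_decomposition G' T0' d'" by blast+
  have "fst t = imbalance_of T0" "fst t' = imbalance_of T0'"
    using has_triple_eq[OF a(1,3,2)] has_triple_eq[OF a'(1,3,2)] by simp_all
  then show "t = t' \<longleftrightarrow> imbalance_of T0 = imbalance_of T0' \<and> composition_of d = composition_of d'"
    using composition_table_functional[OF has_triple_in_table[OF a] has_triple_in_table[OF a']]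
    by simp
next
  show "{t. (triple_class t :: ((nat \<times> nat) set \<times> (nat, nat) brick) set) = {}}
      = {t. \<not> law_I t \<or> \<not> law_II t}"
    using nonempty_class_iff lawful_iff by blast
next
  fix G :: "('r \<times> 'c) set" and T0 d
  assume "tall_grid G T0 \<and> excessive_decomposition G T0 d \<and> excessive G T0"
  then show "d = (if balanced T0 then Decomposition None [T0] None
      else Decomposition None [] (Some T0))"
    using excessive_grid_decomposition by blast
next
  fix G :: "('r \<times> 'c) set" and T0 d
  assume "tall_grid G T0 \<and> excessive_decomposition G T0 d \<and> liminal G T0"
  then have l: "tall_grid G T0" "excessive_decomposition G T0 d" "liminal G T0" by blast+
  show "1 \<le> length (C_blocks d)" using liminal_C_count[OF l] by blast
  show "2 \<le> length (C_blocks d)" if "balanced T0" using liminal_C_count[OF l] that by blast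
qed (rule card_UNIV_triple card_table card_unlawful)+

end
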